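(* There exist a compact metrizable space $X$ and a homeomorphism $T:X\to X$ such that the cascade $(X,T)$ is minimal and PI (of order $3$), and its enveloping semigroup $E(X,T)$ has exactly $\mathfrak{c}=2^{\aleph_0}$ minimal left ideals.
   Context: A cascade $(X,T)$ is a compact space $X$ with a homeomorphism $T$, regarded as a flow of the acting group $G=\mathbb{Z}$ via $n\cdot x=T^nx$. More generally a flow $(X,G)$ is a compact Hausdorff space $X$ with a continuous homomorphism of a topological group $G$ into $\mathrm{Homeo}(X)$, written $(g,x)\mapsto gx$. It is minimal if every orbit $Gx$ is dense in $X$. A homomorphism of flows is a continuous $G$-equivariant map (automatically surjective when the target is minimal); one also calls it an extension of its target. Enveloping semigroup: $E(X,G)$ is the closure in $X^X$ (product topology) of the set of maps $\{x\mapsto gx : g\in G\}$ (so $E(X,T)$ is the closure of $\{T^n:n\in\mathbb{Z}\}$); it is a semigroup under composition. A left ideal is a nonempty subset $I\subset E(X,G)$ with $E(X,G)\,I\subset I$; it is minimal if it contains no strictly smaller left ideal. Two points $x_1,x_2$ of a flow are proximal if there is a net $g_i\in G$ with $\lim g_ix_1=\lim g_ix_2$. An extension $\phi:W'\to W$ is proximal if any two points with the same image under $\phi$ are proximal. It is equicontinuous if, with $R_\phi=\{(a,b)\in W'\times W':\phi(a)=\phi(b)\}$, for every neighborhood $\alpha$ of the diagonal in $W'\times W'$ there is a neighborhood $\beta$ of the diagonal such that $(ga,gb)\in\alpha$ for all $g\in G$ and all $(a,b)\in\beta\cap R_\phi$ (for metrizable minimal flows such extensions are also called isometric). A minimal flow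 $(X,G)$ is strictly PI if there are an ordinal $\eta$ and a family of minimal flows $\{W_\iota\}_{\iota\le\eta}$ such that: $W_0$ is the trivial (one-point) flow; for every $\iota<\eta$ there is a homomorphism $\phi_\iota:W_{\iota+1}\to W_\iota$ which is either proximal or equicontinuous; for every limit ordinal $\nu\le\eta$, $W_\nu$ is the inverse limit of $\{W_\iota\}_{\iota<\nu}$; and $W_\eta=X$. A minimal flow $(X,G)$ is a PI-flow if there exist a strictly PI flow $\tilde X$ and a proximal homomorphism $\theta:\tilde X\to X$. "PI of order $n$" ($n\in\mathbb{N}$) means: strictly PI via such a tower of length $\eta=n$, i.e. obtained from the trivial flow by $n$ successive extensions, each non-trivial (not an isomorphism) and each either proximal or equicontinuous. *)

theory Defs
  imports "HOL-Analysis.Analysis" "HOL-Library.Equipollence"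
begin

(* Spaces are abstract topologies X :: 'a topology and a self-map T is a total function of which
   only the values on topspace X matter. *)

section \<open>Cascades\<close>

(* The integer iterates of T; negative ones use the inverse of T on the carrier. *)
definition zpow :: "'a topology \<Rightarrow> ('a \<Rightarrow> 'a) \<Rightarrow> int \<Rightarrow> 'a \<Rightarrow> 'a" where
  "zpow X T n = (if 0 \<le> n then T ^^ nat n else inv_into (topspace X) T ^^ nat (- n))"

definition cascade :: "'a topology \<Rightarrow> ('a \<Rightarrow> 'a) \<Rightarrow> bool" where
  "cascade X T \<longleftrightarrow> compact_space X \<and> Hausdorff_space X \<and> homeomorphic_map X X T"

(* Minimal flows are nonempty; otherwise the empty cascade would be a (proximal and
   equicontinuous) extension of every cascade. *)
definition minimal_cascade :: "'a topology \<Rightarrow> ('a \<Rightarrow> 'a) \<Rightarrow> bool" where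
  "minimal_cascade X T \<longleftrightarrow> cascade X T \<and> topspace X \<noteq> {} \<and>
     (\<forall>x \<in> topspace X. X closure_of range (\<lambda>n. zpow X T n x) = topspace X)"

definition cascade_hom ::
    "'a topology \<Rightarrow> ('a \<Rightarrow> 'a) \<Rightarrow> 'b topology \<Rightarrow> ('b \<Rightarrow> 'b) \<Rightarrow> ('a \<Rightarrow> 'b) \<Rightarrow> bool" where
  "cascade_hom Y S X T \<phi> \<longleftrightarrow> continuous_map Y X \<phi> \<and>
     (\<forall>n. \<forall>y \<in> topspace Y. \<phi> (zpow Y S n y) = zpow X T n (\<phi> y))"

section \<open>Enveloping semigroup\<close>

(* X^X is realised as the product topology on functions that are extensional on topspace X. *)
definition enveloping_semigroup :: "'a topology \<Rightarrow> ('a \<Rightarrow> 'a) \<Rightarrow> ('a \<Rightarrow> 'a) set" where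
  "enveloping_semigroup X T =
     product_topology (\<lambda>_. X) (topspace X) closure_of
       range (\<lambda>n. restrict (zpow X T n) (topspace X))"

definition left_ideal :: "'a topology \<Rightarrow> ('a \<Rightarrow> 'a) \<Rightarrow> ('a \<Rightarrow> 'a) set \<Rightarrow> bool" where
  "left_ideal X T I \<longleftrightarrow> I \<noteq> {} \<and> I \<subseteq> enveloping_semigroup X T \<and>
     (\<forall>p \<in> enveloping_semigroup X T. \<forall>q \<in> I. compose (topspace X) p q \<in> I)"

definition minimal_left_ideal :: "'a topology \<Rightarrow> ('a \<Rightarrow> 'a) \<Rightarrow> ('a \<Rightarrow> 'a) set \<Rightarrow> bool" where
  "minimal_left_ideal X T I \<longleftrightarrow> left_ideal X T I \<and> \<not> (\<exists>J. left_ideal X T J \<and> J \<subset> I)"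

section \<open>Proximal and equicontinuous extensions\<close>

(* A net in the acting group is given by the proper filter it generates on int. *)
definition proximal :: "'a topology \<Rightarrow> ('a \<Rightarrow> 'a) \<Rightarrow> 'a \<Rightarrow> 'a \<Rightarrow> bool" where
  "proximal X T x y \<longleftrightarrow> (\<exists>F z. F \<noteq> bot \<and>
     limitin X (\<lambda>n. zpow X T n x) z F \<and> limitin X (\<lambda>n. zpow X T n y) z F)"

definition proximal_extension ::
    "'a topology \<Rightarrow> ('a \<Rightarrow> 'a) \<Rightarrow> 'b topology \<Rightarrow> ('b \<Rightarrow> 'b) \<Rightarrow> ('a \<Rightarrow> 'b) \<Rightarrow> bool" where
  "proximal_extension Y S X T \<phi> \<longleftrightarrow> cascade_hom Y S X T \<phi> \<and>
     (\<forall>a \<in> topspace Y. \<forall>b \<in> topspace Y. \<phi> a = \<phi> b \<longrightarrow> proximal Y S a b)"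

definition diagonal_nbhd :: "'a topology \<Rightarrow> ('a \<times> 'a) set \<Rightarrow> bool" where
  "diagonal_nbhd X \<alpha> \<longleftrightarrow> \<alpha> \<subseteq> topspace X \<times> topspace X \<and>
     (\<exists>U. openin (prod_topology X X) U \<and> Id_on (topspace X) \<subseteq> U \<and> U \<subseteq> \<alpha>)"

definition equicontinuous_extension ::
    "'a topology \<Rightarrow> ('a \<Rightarrow> 'a) \<Rightarrow> 'b topology \<Rightarrow> ('b \<Rightarrow> 'b) \<Rightarrow> ('a \<Rightarrow> 'b) \<Rightarrow> bool" where
  "equicontinuous_extension Y S X T \<phi> \<longleftrightarrow> cascade_hom Y S X T \<phi> \<and>
     (\<forall>\<alpha>. diagonal_nbhd Y \<alpha> \<longrightarrow> (\<exists>\<beta>. diagonal_nbhd Y \<beta> \<and>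
        (\<forall>(a, b) \<in> \<beta>. \<phi> a = \<phi> b \<longrightarrow> (\<forall>n. (zpow Y S n a, zpow Y S n b) \<in> \<alpha>))))"

section \<open>PI-flows\<close>

(* The ordinals up to and including \<eta> are the field of a well-order r with greatest element \<eta>.
   For i, k in Field r: k is the successor of i iff underS r k = under r i; k is zero iff underS r k
   is empty; all other k are limits.  \<pi> i k : W k \<rightarrow> W i are the bonding maps of the tower
   (\<pi> i k is the given extension if k is the successor of i); W k is the inverse limit at a limit k
   if the canonical map is a homeomorphism onto the space of threads. *)
definition PI_tower ::
    "'i rel \<Rightarrow> 'i \<Rightarrow> ('i \<Rightarrow> 'a topology) \<Rightarrow> ('i \<Rightarrow> 'a \<Rightarrow> 'a) \<Rightarrow> ('i \<Rightarrow> 'i \<Rightarrow> 'a \<Rightarrow> 'a) \<Rightarrow> bool" where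
  "PI_tower r \<eta> W S \<pi> \<longleftrightarrow>
     Well_order r \<and> \<eta> \<in> Field r \<and> under r \<eta> = Field r \<and>
     (\<forall>i \<in> Field r. minimal_cascade (W i) (S i)) \<and>
     (\<forall>i \<in> Field r. underS r i = {} \<longrightarrow> (\<exists>w. topspace (W i) = {w})) \<and>
     (\<forall>i k. (i, k) \<in> r \<longrightarrow> cascade_hom (W k) (S k) (W i) (S i) (\<pi> i k)) \<and>
     (\<forall>i \<in> Field r. \<forall>x \<in> topspace (W i). \<pi> i i x = x) \<and>
     (\<forall>i j k. (i, j) \<in> r \<longrightarrow> (j, k) \<in> r \<longrightarrow>
        (\<forall>x \<in> topspace (W k). \<pi> i j (\<pi> j k x) = \<pi> i k x)) \<and>
     (\<forall>i \<in> Field r. \<forall>k \<in> Field r. underS r k = under r i \<longrightarrow>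
        proximal_extension (W k) (S k) (W i) (S i) (\<pi> i k) \<or>
        equicontinuous_extension (W k) (S k) (W i) (S i) (\<pi> i k)) \<and>
     (\<forall>k \<in> Field r. underS r k \<noteq> {} \<and> (\<forall>i \<in> Field r. underS r k \<noteq> under r i) \<longrightarrow>
        homeomorphic_map (W k)
          (subtopology (product_topology W (underS r k))
             {t. \<forall>i \<in> underS r k. \<forall>j \<in> underS r k. (i, j) \<in> r \<longrightarrow> \<pi> i j (t j) = t i})
          (\<lambda>x. \<lambda>i \<in> underS r k. \<pi> i k x))"

(* The spaces of the tower are factors of X and its distinct stages correspond to a strictly
   decreasing well-ordered chain of equivalence relations on X, so 'a is large enough both to carry
   the spaces and to index the tower. *)
definition strictly_PI :: "'a topology \<Rightarrow> ('a \<Rightarrow> 'a) \<Rightarrow> bool" where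
  "strictly_PI X T \<longleftrightarrow>
     (\<exists>(r :: 'a rel) \<eta> W S \<pi>. PI_tower r \<eta> W S \<pi> \<and> W \<eta> = X \<and> S \<eta> = T)"

(* HOL cannot quantify over types, so the strictly PI extension is sought on the type of X; this can
   only strengthen the notion.  A strictly PI flow is PI, with \<theta> the identity. *)
definition PI_flow :: "'a topology \<Rightarrow> ('a \<Rightarrow> 'a) \<Rightarrow> bool" where
  "PI_flow X T \<longleftrightarrow> minimal_cascade X T \<and>
     (\<exists>(Y :: 'a topology) S \<theta>. strictly_PI Y S \<and> proximal_extension Y S X T \<theta>)"

(* natLeq_on (Suc n) is the usual order on {0..n}. *)
definition PI_of_order :: "nat \<Rightarrow> 'a topology \<Rightarrow> ('a \<Rightarrow> 'a) \<Rightarrow> bool" where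
  "PI_of_order n X T \<longleftrightarrow>
     (\<exists>W S \<pi>. PI_tower (natLeq_on (Suc n)) n W S \<pi> \<and> W n = X \<and> S n = T \<and>
        (\<forall>i < n. \<not> homeomorphic_map (W (Suc i)) (W i) (\<pi> i (Suc i))))"

end

theory Submission
  imports Defs "HOL-Real_Asymp.Real_Asymp"
begin

text \<open>The example is a circle extension of an almost one-to-one symbolic extension of the dyadic
  odometer.  A point consists of a \<open>2\<close>-adic integer \<open>x\<close>, a two-sided \<open>0\<close>-\<open>1\<close> sequence \<open>s\<close> and a
  complex number \<open>z\<close> of modulus \<open>1\<close>.  Where \<open>x + k\<close> is not zero, the symbol \<open>s k\<close> is the parity of
  the \<open>2\<close>-adic valuation of \<open>x + k\<close>; where \<open>x + k = 0\<close>, both values are admitted.  Thus the fibre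
  over \<open>x\<close> in the space of pairs \<open>(x, s)\<close> is a single point unless \<open>x\<close> is an integer, and then it
  has two points, which differ at one position only.  The two points over \<open>x = 0\<close> (with \<open>z = 1\<close>)
  are called the twins.  The homeomorphism adds \<open>1\<close> to \<open>x\<close>, shifts \<open>s\<close>, and rotates \<open>z\<close> by the
  angle \<open>jump v * s (- (2 ^ v))\<close>, where \<open>v\<close> is the valuation of \<open>x\<close> and
  \<open>jump v = sqrt (v + 1) - sqrt v\<close>.

  The angle depends continuously on the point because \<open>jump\<close> tends to \<open>0\<close>, but along the orbits
  of the twins it differs exactly at the times \<open>2 ^ i\<close>, by \<open>jump i\<close>.  After \<open>2 ^ m\<close> steps the
  phases of the twins have therefore drifted apart by \<open>sqrt m\<close>.  This tends to infinity with steps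
  tending to \<open>0\<close>, so modulo \<open>2 * pi\<close> the drift accumulates at every angle: for every \<open>c\<close> on the
  unit circle there are times along which the twins become asymptotic up to the rotation by \<open>c\<close>
  (\<open>twins_asymptotic\<close>).  Everything else follows from this.

  Minimality.  A minimal closed invariant set lies over all pairs \<open>(x, s)\<close>.  Moving its points over
  the two twins along such times yields, for every rotation, a point of the set whose image under the
  rotation is again in the set; by minimality the set is invariant under all rotations, so it is
  everything.

  The tower.  The odometer is equicontinuous.  The pairs \<open>(x, s)\<close> form a proximal extension of it,
  since two points of a fibre differ at one position, which is shifted away.  The whole space is an
  equicontinuous extension of the space of pairs, as rotations of the circle are isometries.

  Left ideals.  An element \<open>p\<close> of a minimal left ideal maps the twins into one circle, and the
  rotation \<open>c\<close> between the two images is the same for all elements of the ideal.  Every \<open>c\<close> occurs,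
  by the drift.  Conversely \<open>c\<close> determines the ideal: solve \<open>q p = p\<close> in the ideal.  Then \<open>q\<close> fixes
  the range of \<open>p\<close>, which meets every fibre over the odometer, so \<open>q\<close> can move only points over
  integers, and it moves them to the point that every \<open>r\<close> with the same \<open>c\<close> identifies with them.
  Hence \<open>r q = r\<close>, and \<open>r\<close> lies in the ideal.  So the minimal left ideals correspond to the points
  of the unit circle (\<open>minimal_left_ideals_eqpoll_circle\<close>).\<close>

section \<open>Iterates of a bijection\<close>

lemma zpow_0 [simp]: "zpow X T 0 x = x"
  by (simp add: zpow_def)

lemma zpow_in:
  assumes bij: "bij_betw T (topspace X) (topspace X)" and x: "x \<in> topspace X"
  shows "zpow X T n x \<in> topspace X"
proof -
  have "(T ^^ k) x \<in> topspace X" for k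
    by (induction k) (use bij x in \<open>auto dest: bij_betwE\<close>)
  moreover have "(inv_into (topspace X) T ^^ k) x \<in> topspace X" for k
    by (induction k) (use bij_betw_inv_into[OF bij] x in \<open>auto dest: bij_betwE\<close>)
  ultimately show ?thesis
    by (simp add: zpow_def)
qed

lemma zpow_plus1:
  assumes bij: "bij_betw T (topspace X) (topspace X)" and x: "x \<in> topspace X"
  shows "zpow X T (n + 1) x = T (zpow X T n x)"
proof (cases "0 \<le> n")
  case True
  then show ?thesis
    by (simp add: zpow_def nat_add_distrib)
next
  case False
  define m where "m = nat (- n - 1)"
  have n: "nat (- n) = Suc m" and "nat (- (n + 1)) = m"
    using False by (auto simp: m_def)
  have "zpow X T n x = inv_into (topspace X) T (zpow X T (n + 1) x)"
  proof (cases "n = -1")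
    case True
    then show ?thesis by (simp add: zpow_def)
  next
    case F: False
    then show ?thesis
      using False n \<open>nat (- (n + 1)) = m\<close> by (simp add: zpow_def)
  qed
  then show ?thesis
    using bij_betw_inv_into_right[OF bij zpow_in[OF bij x]] by simp
qed

text \<open>Commuting with the maps themselves suffices for commuting with all their integer iterates: the
  negative iterates follow by injectivity.\<close>

lemma zpow_equivariant:
  assumes T: "bij_betw T (topspace X) (topspace X)" and S: "bij_betw S (topspace Y) (topspace Y)"
    and \<phi>: "\<And>y. y \<in> topspace Y \<Longrightarrow> \<phi> y \<in> topspace X"
    and eq: "\<And>y. y \<in> topspace Y \<Longrightarrow> \<phi> (S y) = T (\<phi> y)"
    and y: "y \<in> topspace Y"
  shows "\<phi> (zpow Y S n y) = zpow X T n (\<phi> y)"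
proof (induction n rule: int_induct[where k = 0])
  case base
  then show ?case by simp
next
  case (step1 i)
  then show ?case
    by (simp add: zpow_plus1 T S y \<phi> eq zpow_in)
next
  case (step2 i)
  have "T (\<phi> (zpow Y S (i - 1) y)) = \<phi> (zpow Y S i y)"
    using zpow_plus1[OF S y, of "i - 1"] by (simp add: eq zpow_in S y)
  also have "\<dots> = T (zpow X T (i - 1) (\<phi> y))"
    using zpow_plus1[OF T \<phi>[OF y], of "i - 1"] step2 by simp
  finally show ?case
    by (rule inj_onD[OF bij_betw_imp_inj_on[OF T]]) (simp_all add: zpow_in S y \<phi> T)
qed

lemma zpow_add:
  assumes T: "bij_betw T (topspace X) (topspace X)" and x: "x \<in> topspace X"
  shows "zpow X T (m + n) x = zpow X T m (zpow X T n x)"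
proof (induction m rule: int_induct[where k = 0])
  case base
  then show ?case by simp
next
  case (step1 i)
  then show ?case
    using zpow_plus1[OF T x, of "i + n"] zpow_plus1[OF T zpow_in[OF T x], of i n]
    by (simp add: algebra_simps)
next
  case (step2 i)
  have "T (zpow X T (i - 1 + n) x) = zpow X T (i + n) x"
    using zpow_plus1[OF T x, of "i - 1 + n"] by (simp add: algebra_simps)
  also have "\<dots> = T (zpow X T (i - 1) (zpow X T n x))"
    using zpow_plus1[OF T zpow_in[OF T x], of "i - 1" n] step2 by simp
  finally show ?case
    by (rule inj_onD[OF bij_betw_imp_inj_on[OF T]]) (simp_all add: zpow_in T x)
qed

lemma homeomorphic_map_imp_bij_betw:
  "homeomorphic_map X Y f \<Longrightarrow> bij_betw f (topspace X) (topspace Y)"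
  by (simp add: bij_betw_def homeomorphic_imp_injective_map homeomorphic_imp_surjective_map)

lemma continuous_map_funpow:
  assumes "continuous_map X X f"
  shows "continuous_map X X (f ^^ k)"
  using assms by (induction k) (auto simp: o_def intro: continuous_map_compose[unfolded o_def])

lemma continuous_map_zpow:
  assumes "homeomorphic_map X X T"
  shows "continuous_map X X (zpow X T n)"
proof -
  have "continuous_map X X (inv_into (topspace X) T)"
  proof -
    obtain g where g: "homeomorphic_maps X X T g"
      using assms homeomorphic_map_maps by blast
    have "inv_into (topspace X) T x = g x" if "x \<in> topspace X" for x
    proof (rule inv_into_f_eq)
      show "inj_on T (topspace X)"
        using assms homeomorphic_imp_injective_map by blast
      show "g x \<in> topspace X" "T (g x) = x"
        using g that by (auto simp: homeomorphic_maps_def continuous_map_def Pi_def)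
    qed
    then show ?thesis
      using g continuous_map_eq[of X X g] by (simp add: homeomorphic_maps_def)
  qed
  then show ?thesis
    using assms by (simp add: zpow_def continuous_map_funpow homeomorphic_imp_continuous_map)
qed

section \<open>Minimal closed sets\<close>

text \<open>Zorn's lemma for a property of closed sets that is stable under intersections.  It yields both
  minimal invariant subsets of a cascade and minimal left ideals.\<close>

lemma minimal_closed_subset_exists:
  assumes X: "compact_space X" and A: "closedin X A" "A \<noteq> {}" "P A"
    and inter: "\<And>\<C>. \<lbrakk>\<C> \<noteq> {}; \<And>C. C \<in> \<C> \<Longrightarrow> closedin X C \<and> P C\<rbrakk> \<Longrightarrow> P (\<Inter>\<C>)"
  obtains M where "M \<subseteq> A" "closedin X M" "M \<noteq> {}" "P M"
    "\<And>N. \<lbrakk>N \<subseteq> M; closedin X N; N \<noteq> {}; P N\<rbrakk> \<Longrightarrow> N = M"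
proof -
  define \<F> where "\<F> = {C. C \<subseteq> A \<and> closedin X C \<and> C \<noteq> {} \<and> P C}"
  have "\<exists>M\<in>uminus ` \<F>. \<forall>N\<in>uminus ` \<F>. M \<subseteq> N \<longrightarrow> N = M"
  proof (rule subset_Zorn_nonempty)
    show "uminus ` \<F> \<noteq> {}"
      using A by (auto simp: \<F>_def)
    fix \<D> assume ne: "\<D> \<noteq> {}" and ch: "subset.chain (uminus ` \<F>) \<D>"
    define \<C> where "\<C> = uminus ` \<D>"
    have \<C>: "\<C> \<noteq> {}" "\<C> \<subseteq> \<F>" "\<And>C D. \<lbrakk>C \<in> \<C>; D \<in> \<C>\<rbrakk> \<Longrightarrow> C \<subseteq> D \<or> D \<subseteq> C"
      using ne ch by (auto simp: \<C>_def subset.chain_def subset_iff)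
    have "\<Inter>\<C> \<noteq> {}"
    proof -
      have fin: "\<Inter>\<G> \<in> \<G>" if "finite \<G>" "\<G> \<noteq> {}" "\<G> \<subseteq> \<C>" for \<G>
        using that
      proof (induction \<G> rule: finite_ne_induct)
        case (insert C \<G>)
        then have "\<Inter>\<G> \<subseteq> C \<or> C \<subseteq> \<Inter>\<G>"
          using \<C>(3)[of "\<Inter>\<G>" C] by blast
        then show ?case
          using insert by (metis Inter_insert inf.absorb1 inf.absorb2 insert_iff insert_subset)
      qed simp
      show ?thesis
        using X[unfolded compact_space_fip, rule_format, of \<C>] fin \<C>(2)
        by (auto simp: \<F>_def)
    qed
    moreover have "P (\<Inter>\<C>)"
      using inter[OF \<C>(1)] \<C>(2) by (auto simp: \<F>_def)
    moreover have "closedin X (\<Inter>\<C>)"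
      using \<C>(1,2) by (auto simp: \<F>_def)
    moreover have "\<Inter>\<C> \<subseteq> A"
      using \<C>(1,2) unfolding \<F>_def by blast
    ultimately have "\<Inter>\<C> \<in> \<F>"
      by (simp add: \<F>_def)
    then show "\<Union>\<D> \<in> uminus ` \<F>"
      by (rule rev_image_eqI) (auto simp: \<C>_def)
  qed
  then obtain M where "M \<in> \<F>" and M: "\<And>N. \<lbrakk>N \<in> \<F>; N \<subseteq> M\<rbrakk> \<Longrightarrow> N = M"
    by (auto simp: ball_simps)
  show thesis
  proof (rule that)
    show "M \<subseteq> A" "closedin X M" "M \<noteq> {}" "P M"
      using \<open>M \<in> \<F>\<close> by (auto simp: \<F>_def)
    show "N = M" if "N \<subseteq> M" "closedin X N" "N \<noteq> {}" "P N" for N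
      using M that \<open>M \<in> \<F>\<close> by (auto simp: \<F>_def)
  qed
qed

section \<open>The enveloping semigroup\<close>

lemma enveloping_semigroup_closed:
  "closedin (product_topology (\<lambda>_. X) (topspace X)) (enveloping_semigroup X T)"
  by (simp add: enveloping_semigroup_def)

lemma enveloping_semigroup_ext:
  "p \<in> enveloping_semigroup X T \<Longrightarrow> p \<in> topspace X \<rightarrow>\<^sub>E topspace X"
  using closedin_subset[OF enveloping_semigroup_closed, of X T] by auto

lemma enveloping_semigroup_in:
  "\<lbrakk>p \<in> enveloping_semigroup X T; x \<in> topspace X\<rbrakk> \<Longrightarrow> p x \<in> topspace X"
  using enveloping_semigroup_ext by (blast dest: PiE_mem)

lemma zpow_in_enveloping_semigroup:
  assumes "homeomorphic_map X X T"
  shows "restrict (zpow X T n) (topspace X) \<in> enveloping_semigroup X T"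
proof -
  have "range (\<lambda>n. restrict (zpow X T n) (topspace X))
      \<subseteq> topspace (product_topology (\<lambda>_. X) (topspace X))"
    using zpow_in[OF homeomorphic_map_imp_bij_betw[OF assms]] by auto
  then show ?thesis
    unfolding enveloping_semigroup_def using closure_of_subset by blast
qed

lemma enveloping_semigroup_eqI:
  assumes "p \<in> enveloping_semigroup X T" "q \<in> enveloping_semigroup X T"
    and "\<And>x. x \<in> topspace X \<Longrightarrow> p x = q x"
  shows "p = q"
  using PiE_ext[OF enveloping_semigroup_ext[OF assms(1)] enveloping_semigroup_ext[OF assms(2)]] assms(3)
  by blast

text \<open>An identity between values of an element of the enveloping semigroup passes from the
  iterates to all elements as soon as both sides are continuous for pointwise convergence.\<close>

lemma enveloping_semigroup_identity:
  assumes "p \<in> enveloping_semigroup X T" and "Hausdorff_space Y"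
    and "continuous_map (product_topology (\<lambda>_. X) (topspace X)) Y u"
    and "continuous_map (product_topology (\<lambda>_. X) (topspace X)) Y v"
    and "\<And>n. u (restrict (zpow X T n) (topspace X)) = v (restrict (zpow X T n) (topspace X))"
  shows "u p = v p"
  by (rule forall_in_closure_of_eq[OF assms(1)[unfolded enveloping_semigroup_def] assms(2,3,4)])
     (use assms(5) in auto)

lemma continuous_map_apply:
  "x \<in> topspace X \<Longrightarrow> continuous_map (product_topology (\<lambda>_. X) (topspace X)) X (\<lambda>p. p x)"
  by (rule continuous_map_product_projection)

text \<open>Each continuous symmetry of the cascade commutes with the whole enveloping semigroup, although the
  elements of the latter need not be continuous.\<close>

lemma enveloping_semigroup_commute:
  assumes "cascade X T" "p \<in> enveloping_semigroup X T"
    and h: "continuous_map X X h" "\<And>x. x \<in> topspace X \<Longrightarrow> h (T x) = T (h x)"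
    and x: "x \<in> topspace X"
  shows "p (h x) = h (p x)"
proof (rule enveloping_semigroup_identity[OF assms(2)])
  have bij: "bij_betw T (topspace X) (topspace X)"
    using assms(1) by (simp add: cascade_def homeomorphic_map_imp_bij_betw)
  have hx: "h y \<in> topspace X" if "y \<in> topspace X" for y
    using h(1) that by (auto simp: continuous_map_def)
  show "Hausdorff_space X"
    using assms(1) by (simp add: cascade_def)
  show "continuous_map (product_topology (\<lambda>_. X) (topspace X)) X (\<lambda>p. p (h x))"
    by (rule continuous_map_apply[OF hx[OF x]])
  show "continuous_map (product_topology (\<lambda>_. X) (topspace X)) X (\<lambda>p. h (p x))"
    using continuous_map_compose[OF continuous_map_apply[OF x] h(1)] by (simp add: o_def)
  show "restrict (zpow X T n) (topspace X) (h x) = h (restrict (zpow X T n) (topspace X) x)" for n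
    using zpow_equivariant[of T X T X h, OF bij bij hx h(2) x, of n] hx x by simp
qed

text \<open>The composition is continuous in its left argument, and in its right argument if the left one is
  an iterate.  So the closure of the iterates is first stable under iterates from the left and then
  under all its elements.\<close>

lemma enveloping_semigroup_compose:
  assumes c: "cascade X T" and p: "p \<in> enveloping_semigroup X T"
    and q: "q \<in> enveloping_semigroup X T"
  shows "compose (topspace X) p q \<in> enveloping_semigroup X T"
proof -
  let ?P = "product_topology (\<lambda>_. X) (topspace X)" and ?E = "enveloping_semigroup X T"
  let ?T = "\<lambda>n. restrict (zpow X T n) (topspace X)"
  have hom: "homeomorphic_map X X T" and bij: "bij_betw T (topspace X) (topspace X)"
    using c by (simp_all add: cascade_def homeomorphic_map_imp_bij_betw)
  have ext: "compose (topspace X) f g \<in> topspace X \<rightarrow>\<^sub>E topspace X"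
    if "f \<in> topspace X \<rightarrow> topspace X" "g \<in> topspace X \<rightarrow> topspace X" for f g
    using that by (auto simp: compose_def)
  have left: "compose (topspace X) (?T m) q \<in> ?E" if q: "q \<in> ?E" for m q
  proof -
    have cont: "continuous_map ?P ?P (compose (topspace X) (?T m))"
    proof (subst continuous_map_componentwise, intro conjI ballI)
      fix x assume x: "x \<in> topspace X"
      have "continuous_map ?P X (zpow X T m \<circ> (\<lambda>p. p x))"
        by (rule continuous_map_compose[OF continuous_map_apply[OF x] continuous_map_zpow[OF hom]])
      then show "continuous_map ?P X (\<lambda>p. compose (topspace X) (?T m) p x)"
        by (rule continuous_map_eq) (use x in \<open>auto simp: compose_def\<close>)
    qed (auto simp: compose_def)
    have "compose (topspace X) (?T m) ` (?P closure_of range ?T)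
        \<subseteq> ?P closure_of (compose (topspace X) (?T m) ` range ?T)"
      by (rule continuous_map_image_closure_subset[OF cont])
    also have "\<dots> \<subseteq> ?P closure_of (range ?T)"
    proof (rule closure_of_mono, clarify)
      fix n
      have "compose (topspace X) (?T m) (?T n) = ?T (m + n)"
        by (auto simp: compose_def fun_eq_iff zpow_add[OF bij] zpow_in[OF bij])
      then show "compose (topspace X) (?T m) (?T n) \<in> range ?T"
        by (metis rangeI)
    qed
    finally show ?thesis
      using q by (auto simp: enveloping_semigroup_def)
  qed
  have qx: "q x \<in> topspace X" if "x \<in> topspace X" for x
    using enveloping_semigroup_in[OF q that] .
  have cont: "continuous_map ?P ?P (\<lambda>p. compose (topspace X) p q)"
  proof (subst continuous_map_componentwise, intro conjI ballI)
    fix x assume x: "x \<in> topspace X"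
    show "continuous_map ?P X (\<lambda>p. compose (topspace X) p q x)"
      using continuous_map_apply[OF qx[OF x]] x by (simp add: compose_def)
  qed (auto simp: compose_def)
  have "(\<lambda>p. compose (topspace X) p q) ` (?P closure_of range ?T)
      \<subseteq> ?P closure_of ((\<lambda>p. compose (topspace X) p q) ` range ?T)"
    by (rule continuous_map_image_closure_subset[OF cont])
  also have "\<dots> \<subseteq> ?P closure_of ?E"
    by (rule closure_of_mono) (use left q in auto)
  also have "\<dots> = ?E"
    by (simp add: closure_of_closedin enveloping_semigroup_closed)
  finally show ?thesis
    using p by (auto simp: enveloping_semigroup_def)
qed

lemma compose_enveloping_assoc:
  assumes "q \<in> enveloping_semigroup X T"
  shows "compose (topspace X) r (compose (topspace X) p q)
      = compose (topspace X) (compose (topspace X) r p) q"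
proof
  fix x
  show "compose (topspace X) r (compose (topspace X) p q) x
      = compose (topspace X) (compose (topspace X) r p) q x"
    using enveloping_semigroup_in[OF assms, of x] by (cases "x \<in> topspace X") (simp_all add: compose_def)
qed

lemma left_ideal_principal:
  fixes X :: "'a topology"
  assumes c: "cascade X T" and q: "q \<in> enveloping_semigroup X T"
  shows "left_ideal X T ((\<lambda>p. compose (topspace X) p q) ` enveloping_semigroup X T)"
  unfolding left_ideal_def
proof (intro conjI ballI)
  show "(\<lambda>p. compose (topspace X) p q) ` enveloping_semigroup X T \<noteq> {}"
    using q by blast
  show "(\<lambda>p. compose (topspace X) p q) ` enveloping_semigroup X T \<subseteq> enveloping_semigroup X T"
    using enveloping_semigroup_compose[OF c _ q] by blast
  fix r s assume r: "r \<in> enveloping_semigroup X T"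
    and "s \<in> (\<lambda>p. compose (topspace X) p q) ` enveloping_semigroup X T"
  then obtain p where p: "p \<in> enveloping_semigroup X T" "s = compose (topspace X) p q"
    by blast
  have "compose (topspace X) r s = compose (topspace X) (compose (topspace X) r p) q"
    by (simp add: p compose_enveloping_assoc[OF q])
  then show "compose (topspace X) r s
      \<in> (\<lambda>p. compose (topspace X) p q) ` enveloping_semigroup X T"
    using enveloping_semigroup_compose[OF c r p(1)] by blast
qed

lemma minimal_left_ideal_subset:
  assumes "minimal_left_ideal X T I" "left_ideal X T J" "I \<inter> J \<noteq> {}"
  shows "I \<subseteq> J"
proof -
  have "left_ideal X T (I \<inter> J)"
    using assms by (auto simp: minimal_left_ideal_def left_ideal_def)
  then show ?thesis
    using assms(1) by (auto simp: minimal_left_ideal_def)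
qed

text \<open>The right translates of the ideal by \<open>p\<close> form a left ideal, which by minimality is the whole
  ideal and so contains \<open>p\<close>.\<close>

lemma minimal_left_ideal_left_fix:
  fixes X :: "'a topology"
  assumes "cascade X T" "minimal_left_ideal X T I" "p \<in> I"
  obtains q where "q \<in> I" "compose (topspace X) q p = p"
proof -
  let ?J = "(\<lambda>q. compose (topspace X) q p) ` I"
  have I: "left_ideal X T I"
    using assms by (simp add: minimal_left_ideal_def)
  then have IE: "I \<subseteq> enveloping_semigroup X T" and p: "p \<in> enveloping_semigroup X T"
    using assms by (auto simp: left_ideal_def)
  have J: "left_ideal X T ?J"
    unfolding left_ideal_def
  proof (intro conjI ballI)
    show "?J \<noteq> {}" "?J \<subseteq> enveloping_semigroup X T"
      using assms(1,3) IE p enveloping_semigroup_compose by blast+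
    fix r s assume r: "r \<in> enveloping_semigroup X T" and "s \<in> ?J"
    then obtain q where q: "q \<in> I" "s = compose (topspace X) q p"
      by blast
    have "compose (topspace X) r q \<in> I"
      using I r q by (auto simp: left_ideal_def)
    then show "compose (topspace X) r s \<in> ?J"
      unfolding q compose_enveloping_assoc[OF p] by (rule imageI)
  qed
  have "?J \<inter> I \<noteq> {}"
    using I assms(3) p by (auto simp: left_ideal_def)
  then have "p \<in> ?J"
    using minimal_left_ideal_subset[OF assms(2) J] assms(3) by blast
  then show thesis
    using that by auto
qed

text \<open>Zorn's lemma only gives an ideal that is minimal among the closed ones.  It is minimal among all
  ideals because each left ideal contains a principal one, and principal left ideals are closed as
  continuous images of the compact semigroup.\<close>

lemma minimal_left_ideal_exists:
  assumes c: "cascade X T" and J: "left_ideal X T J"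
    and cl: "closedin (product_topology (\<lambda>_. X) (topspace X)) J"
  obtains I where "I \<subseteq> J" "minimal_left_ideal X T I"
proof -
  let ?P = "product_topology (\<lambda>_. X) (topspace X)" and ?E = "enveloping_semigroup X T"
  let ?inv = "\<lambda>C. \<forall>p\<in>?E. \<forall>q\<in>C. compose (topspace X) p q \<in> C"
  have cpt: "compact_space ?P" and H: "Hausdorff_space ?P"
    using c by (auto simp: cascade_def compact_space_product_topology Hausdorff_space_product_topology)
  have "J \<noteq> {}" and inv: "?inv J" and JE: "J \<subseteq> ?E"
    using J by (auto simp: left_ideal_def)
  obtain I where I: "I \<subseteq> J" "closedin ?P I" "I \<noteq> {}" "?inv I"
    and min: "\<And>N. \<lbrakk>N \<subseteq> I; closedin ?P N; N \<noteq> {}; ?inv N\<rbrakk> \<Longrightarrow> N = I"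
    by (rule minimal_closed_subset_exists[where P = ?inv, OF cpt cl \<open>J \<noteq> {}\<close> inv]) blast+
  have li: "left_ideal X T I"
    using I JE by (auto simp: left_ideal_def)
  have "\<not> L \<subset> I" if L: "left_ideal X T L" for L
  proof
    assume sub: "L \<subset> I"
    obtain q where q: "q \<in> L" "q \<in> ?E"
      using L by (auto simp: left_ideal_def)
    let ?N = "(\<lambda>p. compose (topspace X) p q) ` ?E"
    have N: "left_ideal X T ?N"
      by (rule left_ideal_principal[OF c q(2)])
    have NL: "?N \<subseteq> L"
      using L q by (auto simp: left_ideal_def)
    have "continuous_map ?P ?P (\<lambda>p. compose (topspace X) p q)"
    proof (subst continuous_map_componentwise, intro conjI ballI)
      fix x assume x: "x \<in> topspace X"
      show "continuous_map ?P X (\<lambda>p. compose (topspace X) p q x)"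
        using continuous_map_apply[OF enveloping_semigroup_in[OF q(2) x]] x
        by (simp add: compose_def)
    qed (auto simp: compose_def)
    then have "compactin ?P ?N"
      using image_compactin closedin_compact_space[OF cpt enveloping_semigroup_closed] by blast
    then have "closedin ?P ?N"
      using H compactin_imp_closedin by blast
    then have "?N = I"
      using min[of ?N] N NL sub by (auto simp: left_ideal_def)
    then show False
      using NL sub by blast
  qed
  then have "minimal_left_ideal X T I"
    using li by (auto simp: minimal_left_ideal_def)
  then show thesis
    using that I by blast
qed

text \<open>By compactness the iterates along any sequence of times have a cluster point, and a continuous
  quantity that tends to \<open>0\<close> along the sequence vanishes there.\<close>

lemma enveloping_semigroup_cluster_point:
  fixes \<nu> :: "nat \<Rightarrow> int"
  assumes c: "cascade X T"
  obtains p where "p \<in> enveloping_semigroup X T"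
    "\<And>u :: _ \<Rightarrow> real. \<lbrakk>continuous_map (product_topology (\<lambda>_. X) (topspace X)) euclidean u;
        (\<lambda>j. u (restrict (zpow X T (\<nu> j)) (topspace X))) \<longlonglongrightarrow> 0\<rbrakk> \<Longrightarrow> u p = 0"
proof -
  let ?P = "product_topology (\<lambda>_. X) (topspace X)" and ?E = "enveloping_semigroup X T"
  let ?T = "\<lambda>n. restrict (zpow X T n) (topspace X)"
  define C where "C N = ?P closure_of ((\<lambda>j. ?T (\<nu> j)) ` {N..})" for N
  have E: "?T n \<in> ?E" for n
    using c by (simp add: cascade_def zpow_in_enveloping_semigroup)
  have sub: "(\<lambda>j. ?T (\<nu> j)) ` {N..} \<subseteq> topspace ?P" for N
    using E closedin_subset[OF enveloping_semigroup_closed] by blast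
  have "(\<Inter>N. C N) \<noteq> {}"
  proof (rule compact_space_imp_nest)
    show "compact_space ?P"
      using c by (auto simp: cascade_def compact_space_product_topology)
    show "closedin ?P (C N)" for N
      by (simp add: C_def)
    show "C N \<noteq> {}" for N
    proof -
      have "?T (\<nu> N) \<in> C N"
        using closure_of_subset[OF sub[of N]] unfolding C_def by blast
      then show ?thesis by blast
    qed
    show "decseq C"
      unfolding C_def decseq_def by (intro allI impI closure_of_mono image_mono) simp
  qed
  then obtain p where p: "\<And>N. p \<in> C N"
    by (metis INT_E UNIV_I ex_in_conv)
  have "C 0 \<subseteq> ?E"
    unfolding C_def by (rule closure_of_minimal[OF _ enveloping_semigroup_closed]) (use E in auto)
  then have "p \<in> ?E"
    using p by blast
  moreover have "u p = 0" if u: "continuous_map ?P euclidean u"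
    and lim: "(\<lambda>j. u (?T (\<nu> j))) \<longlonglongrightarrow> 0" for u :: "_ \<Rightarrow> real"
  proof (rule ccontr)
    assume "u p \<noteq> 0"
    then have pos: "\<bar>u p\<bar> / 2 > 0" by simp
    have "\<forall>\<^sub>F j in sequentially. \<bar>u (?T (\<nu> j))\<bar> < \<bar>u p\<bar> / 2"
      by (rule order_tendstoD(2)[OF tendsto_rabs_zero[OF lim] pos])
    then obtain N where N: "\<And>j. j \<ge> N \<Longrightarrow> \<bar>u (?T (\<nu> j))\<bar> < \<bar>u p\<bar> / 2"
      unfolding eventually_sequentially by blast
    let ?U = "{q \<in> topspace ?P. u q \<in> {x. \<bar>x\<bar> > \<bar>u p\<bar> / 2}}"
    have "open {x :: real. \<bar>x\<bar> > \<bar>u p\<bar> / 2}"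
      by (intro open_Collect_less continuous_intros)
    then have U: "openin ?P ?U"
      by (intro openin_continuous_map_preimage[OF u]) simp
    have pU: "p \<in> ?U"
      using \<open>p \<in> ?E\<close> closedin_subset[OF enveloping_semigroup_closed] pos by auto
    have "p \<in> ?P closure_of ((\<lambda>j. ?T (\<nu> j)) ` {N..})"
      using p[of N] by (simp add: C_def)
    then have "p \<in> ?U \<and> openin ?P ?U \<longrightarrow> (\<exists>q. q \<in> (\<lambda>j. ?T (\<nu> j)) ` {N..} \<and> q \<in> ?U)"
      unfolding in_closure_of by (rule conjunct2[THEN spec])
    then have "\<exists>q. q \<in> (\<lambda>j. ?T (\<nu> j)) ` {N..} \<and> q \<in> ?U"
      by (rule mp) (rule conjI[OF pU U])
    then obtain j where "j \<ge> N" "\<bar>u (?T (\<nu> j))\<bar> > \<bar>u p\<bar> / 2"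
      by blast
    then show False
      using N[of j] by simp
  qed
  ultimately show thesis
    by (rule that)
qed

section \<open>Factors of minimal cascades\<close>

lemma cascade_homI:
  assumes "cascade Y S" "cascade X T" "continuous_map Y X \<phi>"
    and "\<And>y. y \<in> topspace Y \<Longrightarrow> \<phi> (S y) = T (\<phi> y)"
  shows "cascade_hom Y S X T \<phi>"
  unfolding cascade_hom_def
proof (intro conjI allI ballI)
  fix n y assume "y \<in> topspace Y"
  then show "\<phi> (zpow Y S n y) = zpow X T n (\<phi> y)"
    using assms by (intro zpow_equivariant)
      (auto simp: cascade_def homeomorphic_map_imp_bij_betw continuous_map_def Pi_def)
qed (rule assms)

text \<open>A continuous image of a minimal cascade is minimal as soon as the map on the cascade induces a
  well-defined injective map on the image.  The induced map is continuous because a continuous map from a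
  compact space onto a Hausdorff space is a quotient map.\<close>

lemma minimal_cascade_factor:
  assumes X: "minimal_cascade X T" and \<phi>: "continuous_map X Y \<phi>" "\<phi> ` topspace X = topspace Y"
    and Y: "Hausdorff_space Y"
    and fib: "\<And>a b. \<lbrakk>a \<in> topspace X; b \<in> topspace X\<rbrakk> \<Longrightarrow> \<phi> (T a) = \<phi> (T b) \<longleftrightarrow> \<phi> a = \<phi> b"
    and S: "\<And>a. a \<in> topspace X \<Longrightarrow> S (\<phi> a) = \<phi> (T a)"
  shows "minimal_cascade Y S"
proof -
  have cX: "compact_space X" and T: "homeomorphic_map X X T"
    using X by (auto simp: minimal_cascade_def cascade_def)
  then have TX: "T ` topspace X = topspace X"
    by (simp add: homeomorphic_imp_surjective_map)
  have cY: "compact_space Y"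
    using image_compactin[OF _ \<phi>(1), of "topspace X"] cX \<phi>(2) by (simp add: compact_space_def)
  have q: "quotient_map X Y \<phi>"
    using continuous_imp_closed_map[OF \<phi>(1) cX Y] \<phi>
    by (simp add: continuous_closed_imp_quotient_map)
  have "continuous_map X Y (\<phi> \<circ> T)"
    by (rule continuous_map_compose[OF homeomorphic_imp_continuous_map[OF T] \<phi>(1)])
  then have "continuous_map X Y (S \<circ> \<phi>)"
    by (rule continuous_map_eq) (simp add: S)
  then have "continuous_map Y Y S"
    using continuous_compose_quotient_map[OF q] by blast
  moreover have "S ` topspace Y = topspace Y"
  proof -
    have "S ` topspace Y = (\<lambda>a. \<phi> (T a)) ` topspace X"
      unfolding \<phi>(2)[symmetric] image_image by (simp add: S)
    also have "\<dots> = \<phi> ` (T ` topspace X)"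
      by (simp add: image_image)
    finally show ?thesis
      by (simp add: TX \<phi>(2))
  qed
  moreover have "inj_on S (topspace Y)"
    unfolding \<phi>(2)[symmetric] by (auto simp: inj_on_def S fib)
  ultimately have hom: "homeomorphic_map Y Y S"
    using continuous_imp_homeomorphic_map cY Y by blast
  then have cas: "cascade Y S"
    using cY Y by (simp add: cascade_def)
  have "cascade_hom X T Y S \<phi>"
    using X by (intro cascade_homI cas \<phi>) (simp_all add: minimal_cascade_def S)
  then have z: "\<phi> (zpow X T n x) = zpow Y S n (\<phi> x)" if "x \<in> topspace X" for n x
    using that by (simp add: cascade_hom_def)
  show ?thesis
    unfolding minimal_cascade_def
  proof (intro conjI ballI cas)
    show "topspace Y \<noteq> {}"
      using X \<phi>(2) by (auto simp: minimal_cascade_def)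
    fix y assume "y \<in> topspace Y"
    then obtain x where x: "x \<in> topspace X" "y = \<phi> x"
      using \<phi>(2) by blast
    have "topspace Y = \<phi> ` (X closure_of range (\<lambda>n. zpow X T n x))"
      using X x by (simp add: minimal_cascade_def \<phi>(2))
    also have "\<dots> \<subseteq> Y closure_of (\<phi> ` range (\<lambda>n. zpow X T n x))"
      by (rule continuous_map_image_closure_subset[OF \<phi>(1)])
    also have "\<phi> ` range (\<lambda>n. zpow X T n x) = range (\<lambda>n. zpow Y S n y)"
      by (simp add: image_image z x)
    finally show "Y closure_of range (\<lambda>n. zpow Y S n y) = topspace Y"
      by (intro equalityI closure_of_subset_topspace)
  qed
qed

section \<open>Towers of finite length\<close>

lemma under_natLeq_on: "i \<le> n \<Longrightarrow> under (natLeq_on (Suc n)) i = {..i}"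
  by (auto simp: under_def)

lemma underS_natLeq_on: "i \<le> n \<Longrightarrow> underS (natLeq_on (Suc n)) i = {..<i}"
  by (auto simp: underS_def)

text \<open>In a tower of finite length each stage but the first is a successor, so the condition on limit
  stages is void.\<close>

lemma PI_tower_finiteI:
  assumes "\<And>i. i \<le> n \<Longrightarrow> minimal_cascade (W i) (S i)"
    and "\<exists>w. topspace (W 0) = {w}"
    and "\<And>i k. \<lbrakk>i \<le> k; k \<le> n\<rbrakk> \<Longrightarrow> cascade_hom (W k) (S k) (W i) (S i) (\<pi> i k)"
    and "\<And>i x. \<lbrakk>i \<le> n; x \<in> topspace (W i)\<rbrakk> \<Longrightarrow> \<pi> i i x = x"
    and "\<And>i j k x. \<lbrakk>i \<le> j; j \<le> k; k \<le> n; x \<in> topspace (W k)\<rbrakk> \<Longrightarrow> \<pi> i j (\<pi> j k x) = \<pi> i k x"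
    and "\<And>i. i < n \<Longrightarrow>
        proximal_extension (W (Suc i)) (S (Suc i)) (W i) (S i) (\<pi> i (Suc i)) \<or>
        equicontinuous_extension (W (Suc i)) (S (Suc i)) (W i) (S i) (\<pi> i (Suc i))"
  shows "PI_tower (natLeq_on (Suc n)) n W S \<pi>"
proof -
  have F: "Field (natLeq_on (Suc n)) = {..n}"
    by (auto simp: Field_natLeq_on)
  have succ: "k = Suc i" if "{..<k} = {..i}" for i k :: nat
    using that by (metis lessThan_Suc_atMost lessThan_eq_iff)
  show ?thesis
    unfolding PI_tower_def F
  proof (intro conjI ballI allI impI)
    show "well_order_on {..n} (natLeq_on (Suc n))"
      using natLeq_on_Well_order[of "Suc n"] by (simp only: F)
    show "proximal_extension (W k) (S k) (W i) (S i) (\<pi> i k) \<or>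
        equicontinuous_extension (W k) (S k) (W i) (S i) (\<pi> i k)"
      if "i \<in> {..n}" "k \<in> {..n}" "underS (natLeq_on (Suc n)) k = under (natLeq_on (Suc n)) i" for i k
      using that assms(6)[of i] succ[of k i]
      by (simp add: under_natLeq_on underS_natLeq_on)
    show "\<exists>w. topspace (W i) = {w}" if "i \<in> {..n}" "underS (natLeq_on (Suc n)) i = {}" for i
      using that assms(2) by (simp add: underS_natLeq_on lessThan_empty_iff bot_nat_def)
  next
    fix k assume k: "k \<in> {..n}"
      and lim: "underS (natLeq_on (Suc n)) k \<noteq> {} \<and>
        (\<forall>i\<in>{..n}. underS (natLeq_on (Suc n)) k \<noteq> under (natLeq_on (Suc n)) i)"
    then obtain i where i: "k = Suc i"
      by (cases k) (auto simp: underS_natLeq_on)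
    then have "underS (natLeq_on (Suc n)) k = under (natLeq_on (Suc n)) i"
      using k by (simp add: under_natLeq_on underS_natLeq_on lessThan_Suc_atMost)
    then show "homeomorphic_map (W k)
          (subtopology (product_topology W (underS (natLeq_on (Suc n)) k))
             {t. \<forall>i \<in> underS (natLeq_on (Suc n)) k. \<forall>j \<in> underS (natLeq_on (Suc n)) k.
               (i, j) \<in> natLeq_on (Suc n) \<longrightarrow> \<pi> i j (t j) = t i})
          (\<lambda>x. \<lambda>i \<in> underS (natLeq_on (Suc n)) k. \<pi> i k x)"
      using lim i k by auto
  qed (use assms under_natLeq_on[of n n] in auto)
qed

text \<open>Any injective relabelling of the stages turns a tower without limit stages into a tower;
  this moves the index set into the type of points.\<close>

lemma PI_tower_relabel:
  fixes h :: "'i \<Rightarrow> 'j"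
  assumes tower: "PI_tower r \<eta> W S \<pi>" and h: "inj h"
    and nolim: "\<And>k. k \<in> Field r \<Longrightarrow> underS r k = {} \<or> (\<exists>i \<in> Field r. underS r k = under r i)"
  shows "PI_tower (dir_image r h) (h \<eta>) (\<lambda>j. W (inv h j)) (\<lambda>j. S (inv h j))
    (\<lambda>i j. \<pi> (inv h i) (inv h j))"
proof -
  have F: "Field (dir_image r h) = h ` Field r"
    by (rule dir_image_Field)
  have mem: "(h i, h k) \<in> dir_image r h \<longleftrightarrow> (i, k) \<in> r" for i k
    using h by (auto simp: dir_image_def inj_eq)
  have range: "\<exists>i' k'. i = h i' \<and> k = h k' \<and> (i', k') \<in> r" if "(i, k) \<in> dir_image r h" for i k
    using that by (auto simp: dir_image_def)
  have under: "under (dir_image r h) (h k) = h ` under r k" for k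
    using h by (auto simp: under_def dir_image_def inj_eq)
  have underS: "underS (dir_image r h) (h k) = h ` underS r k" for k
    using h by (auto simp: underS_def dir_image_def inj_eq)
  have inv: "inv h (h i) = i" for i
    by (rule inv_f_f[OF h])
  have img: "h ` A = h ` B \<longleftrightarrow> A = B" for A B
    by (rule inj_image_eq_iff[OF h])
  have ball: "(\<forall>j\<in>h ` A. P j) \<longleftrightarrow> (\<forall>i\<in>A. P (h i))" for A P
    by blast
  have contr: "\<not> (underS r k \<noteq> {} \<and> (\<forall>i\<in>Field r. underS r k \<noteq> under r i))" if "k \<in> Field r" for k
    using nolim[OF that] by blast
  note t = tower[unfolded PI_tower_def]
  show ?thesis
    unfolding PI_tower_def F ball under underS inv img image_is_empty
  proof (intro conjI)
    have "Well_order (dir_image r h)"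
      by (rule Well_order_dir_image[OF conjunct1[OF t] inj_on_subset[OF h subset_UNIV]])
    then show "well_order_on (h ` Field r) (dir_image r h)"
      by (simp only: F)
    show "h \<eta> \<in> h ` Field r" "under r \<eta> = Field r"
      "\<forall>i\<in>Field r. minimal_cascade (W i) (S i)"
      "\<forall>i\<in>Field r. underS r i = {} \<longrightarrow> (\<exists>w. topspace (W i) = {w})"
      "\<forall>i\<in>Field r. \<forall>x\<in>topspace (W i). \<pi> i i x = x"
      "\<forall>i\<in>Field r. \<forall>k\<in>Field r. underS r k = under r i \<longrightarrow>
        proximal_extension (W k) (S k) (W i) (S i) (\<pi> i k) \<or>
        equicontinuous_extension (W k) (S k) (W i) (S i) (\<pi> i k)"
      using t by auto
    show "\<forall>i k. (i, k) \<in> dir_image r h \<longrightarrow>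
       cascade_hom (W (inv h k)) (S (inv h k)) (W (inv h i)) (S (inv h i)) (\<pi> (inv h i) (inv h k))"
      using t by (auto simp: dir_image_def inv)
    show "\<forall>i j k. (i, j) \<in> dir_image r h \<longrightarrow> (j, k) \<in> dir_image r h \<longrightarrow>
       (\<forall>x\<in>topspace (W (inv h k)). \<pi> (inv h i) (inv h j) (\<pi> (inv h j) (inv h k) x)
          = \<pi> (inv h i) (inv h k) x)"
    proof (intro allI impI ballI)
      fix i j k x assume "(i, j) \<in> dir_image r h" "(j, k) \<in> dir_image r h"
        and x: "x \<in> topspace (W (inv h k))"
      then obtain i' j' k' where "i = h i'" "j = h j'" "k = h k'" "(i', j') \<in> r" "(j', k') \<in> r"
        using range[of i j] range[of j k] h by (auto simp: inj_eq)
      then show "\<pi> (inv h i) (inv h j) (\<pi> (inv h j) (inv h k) x) = \<pi> (inv h i) (inv h k) x"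
        using t x by (simp add: inv)
    qed
  qed (intro ballI impI, erule (1) contr[THEN notE])
qed

lemma finite_PI_tower_imp_strictly_PI:
  fixes X :: "'a topology" and h :: "nat \<Rightarrow> 'a"
  assumes "PI_tower (natLeq_on (Suc n)) n W S \<pi>" "W n = X" "S n = T" "inj h"
  shows "strictly_PI X T"
proof -
  have "underS (natLeq_on (Suc n)) k = {} \<or>
      (\<exists>i\<in>Field (natLeq_on (Suc n)). underS (natLeq_on (Suc n)) k = under (natLeq_on (Suc n)) i)"
    if k: "k \<in> Field (natLeq_on (Suc n))" for k
  proof (cases k)
    case 0
    then show ?thesis by (auto simp: underS_def)
  next
    case (Suc i)
    then show ?thesis
      using k by (auto simp: Field_natLeq_on under_natLeq_on underS_natLeq_on lessThan_Suc_atMost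
          intro!: bexI[of _ i])
  qed
  from PI_tower_relabel[OF assms(1,4) this] show ?thesis
    unfolding strictly_PI_def using assms(2,3) inv_f_f[OF assms(4)] by fastforce
qed

lemma proximal_refl:
  assumes "a \<in> topspace X"
  shows "proximal X T a a"
proof -
  have "limitin X (\<lambda>n. zpow X T n a) a (principal {0})"
    using assms by (simp add: limitin_def eventually_principal)
  then show ?thesis
    unfolding proximal_def by (metis principal_eq_bot_iff insert_not_empty)
qed

lemma strictly_PI_imp_PI_flow:
  assumes "minimal_cascade X T" "strictly_PI X T"
  shows "PI_flow X T"
proof -
  have "proximal_extension X T X T id"
    by (auto simp: proximal_extension_def cascade_hom_def proximal_refl)
  then show ?thesis
    using assms by (auto simp: PI_flow_def)
qed

section \<open>Proximality and equicontinuity along sequences\<close>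

lemma proximal_sequence:
  assumes "limitin X (\<lambda>j. zpow X T (\<nu> j) x) z sequentially"
    and "limitin X (\<lambda>j. zpow X T (\<nu> j) y) z sequentially"
  shows "proximal X T x y"
  unfolding proximal_def
proof (intro exI conjI)
  show "filtermap \<nu> sequentially \<noteq> bot"
    by (simp add: filtermap_bot_iff)
  show "limitin X (\<lambda>n. zpow X T n x) z (filtermap \<nu> sequentially)"
    "limitin X (\<lambda>n. zpow X T n y) z (filtermap \<nu> sequentially)"
    using assms by (simp_all add: limitin_def eventually_filtermap)
qed

lemma tendsto_coordinatewise:
  fixes f :: "'i \<Rightarrow> 'a \<Rightarrow> 'b::topological_space"
  shows "(f \<longlongrightarrow> l) F \<longleftrightarrow> (\<forall>k. ((\<lambda>i. f i k) \<longlongrightarrow> l k) F)"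
proof -
  have "limitin euclidean f l F \<longleftrightarrow> (\<forall>k. limitin euclidean (\<lambda>i. f i k) (l k) F)"
    unfolding euclidean_product_topology[symmetric] limitin_componentwise by simp
  then show ?thesis
    unfolding limitin_canonical_iff .
qed

text \<open>On a compact set of sequences the neighbourhoods of the diagonal are those given by finitely many
  coordinates.  Otherwise there are pairs outside the neighbourhood that get closer and closer in more
  and more coordinates, and they accumulate at a diagonal point.\<close>

lemma compact_nbhd_of_diagonal:
  fixes A :: "(nat \<Rightarrow> real) set"
  assumes A: "compact A" and U: "openin (prod_topology (top_of_set A) (top_of_set A)) U" "Id_on A \<subseteq> U"
  obtains N \<delta> where "\<delta> > 0" "\<And>a b. \<lbrakk>a \<in> A; b \<in> A; \<forall>k<N. \<bar>a k - b k\<bar> < \<delta>\<rbrakk> \<Longrightarrow> (a, b) \<in> U"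
proof (rule ccontr)
  assume none: "\<not> thesis"
  have "\<exists>a b. a \<in> A \<and> b \<in> A \<and> (\<forall>k<n. \<bar>a k - b k\<bar> < inverse (real (Suc n))) \<and> (a, b) \<notin> U" for n
  proof (rule ccontr)
    assume "\<not> ?thesis"
    then show False
      using that[of "inverse (real (Suc n))" n] none by auto
  qed
  then obtain a b where A': "\<And>n. a n \<in> A" "\<And>n. b n \<in> A"
    and near: "\<And>n k. k < n \<Longrightarrow> \<bar>a n k - b n k\<bar> < inverse (real (Suc n))"
    and out: "\<And>n. (a n, b n) \<notin> U"
    by metis
  obtain l r where l: "l \<in> A" and r: "strict_mono (r :: nat \<Rightarrow> nat)" and a: "(a \<circ> r) \<longlonglongrightarrow> l"
    using seq_compactE[OF compact_imp_seq_compact[OF A], of a] A'(1) by blast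
  have "(\<lambda>n. a n k - b n k) \<longlonglongrightarrow> 0" for k
  proof (rule Lim_null_comparison[OF _ LIMSEQ_inverse_real_of_nat])
    show "\<forall>\<^sub>F n in sequentially. norm (a n k - b n k) \<le> inverse (real (Suc n))"
      using eventually_gt_at_top[of k] by eventually_elim (use near in \<open>force intro: less_imp_le\<close>)
  qed
  then have d: "(\<lambda>n. a (r n) k - b (r n) k) \<longlonglongrightarrow> 0" for k
    by (rule LIMSEQ_subseq_LIMSEQ[OF _ r, unfolded o_def])
  have b: "(b \<circ> r) \<longlonglongrightarrow> l"
    unfolding tendsto_coordinatewise
  proof
    fix k
    have "(\<lambda>n. a (r n) k) \<longlonglongrightarrow> l k"
      using a unfolding tendsto_coordinatewise by (simp add: o_def)
    from tendsto_diff[OF this d[of k]] show "(\<lambda>n. (b \<circ> r) n k) \<longlonglongrightarrow> l k"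
      by (simp add: o_def)
  qed
  have "(l, l) \<in> U"
    using l U(2) by auto
  then obtain V V' where V: "openin (top_of_set A) V" "openin (top_of_set A) V'" "l \<in> V" "l \<in> V'" "V \<times> V' \<subseteq> U"
    using U(1) unfolding openin_prod_topology_alt by metis
  have "limitin (top_of_set A) (a \<circ> r) l sequentially" "limitin (top_of_set A) (b \<circ> r) l sequentially"
    using a b l A' by (simp_all add: limitin_subtopology)
  then have "\<forall>\<^sub>F n in sequentially. (a \<circ> r) n \<in> V" "\<forall>\<^sub>F n in sequentially. (b \<circ> r) n \<in> V'"
    using V unfolding limitin_def by blast+
  then have "\<forall>\<^sub>F n in sequentially. False"
    by eventually_elim (use V(5) out in auto)
  then show False
    by simp
qed

lemma coordinatewise_diagonal_nbhd:
  fixes A :: "(nat \<Rightarrow> real) set"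
  assumes "\<delta> > 0"
  shows "diagonal_nbhd (top_of_set A) {(a, b) \<in> A \<times> A. \<forall>k<N. \<bar>a k - b k\<bar> < \<delta>}"
proof -
  let ?P = "prod_topology (top_of_set A) (top_of_set A)"
  let ?U = "{(a, b) \<in> A \<times> A. \<forall>k<N. \<bar>a k - b k\<bar> < \<delta>}"
  have co: "continuous_map (top_of_set A) euclidean (\<lambda>a. a k)" for k
    by (simp add: continuous_on_subset[OF continuous_on_product_coordinates])
  have "continuous_map ?P euclidean (\<lambda>p. fst p k - snd p k)" for k
    using continuous_map_compose[OF continuous_map_fst co] continuous_map_compose[OF continuous_map_snd co]
    unfolding o_def by (intro continuous_map_diff)
  then have "openin ?P {p \<in> topspace ?P. fst p k - snd p k \<in> {-\<delta><..<\<delta>}}" for k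
    by (rule openin_continuous_map_preimage) simp
  then have "openin ?P (topspace ?P \<inter> (\<Inter>k\<in>{..<N}. {p \<in> topspace ?P. fst p k - snd p k \<in> {-\<delta><..<\<delta>}}))"
    by (intro openin_Int_Inter) auto
  moreover have "topspace ?P \<inter> (\<Inter>k\<in>{..<N}. {p \<in> topspace ?P. fst p k - snd p k \<in> {-\<delta><..<\<delta>}}) = ?U"
    by (force simp: abs_less_iff)
  ultimately have "openin ?P ?U"
    by metis
  then show ?thesis
    using assms by (auto simp: diagonal_nbhd_def)
qed

lemma equicontinuous_extension_coordinatewise:
  fixes A :: "(nat \<Rightarrow> real) set"
  assumes A: "compact A" and hom: "cascade_hom (top_of_set A) T Y S \<phi>"
    and T: "bij_betw T A A"
    and unif: "\<And>N \<epsilon>. \<epsilon> > 0 \<Longrightarrow> \<exists>M. \<exists>\<delta>>0. \<forall>a\<in>A. \<forall>b\<in>A. \<phi> a = \<phi> b \<and> (\<forall>k<M. \<bar>a k - b k\<bar> < \<delta>) \<longrightarrow>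
        (\<forall>n. \<forall>k<N. \<bar>zpow (top_of_set A) T n a k - zpow (top_of_set A) T n b k\<bar> < \<epsilon>)"
  shows "equicontinuous_extension (top_of_set A) T Y S \<phi>"
  unfolding equicontinuous_extension_def
proof (intro conjI allI impI hom)
  fix \<alpha> assume "diagonal_nbhd (top_of_set A) \<alpha>"
  then obtain U where U: "openin (prod_topology (top_of_set A) (top_of_set A)) U" "Id_on A \<subseteq> U" "U \<subseteq> \<alpha>"
    by (auto simp: diagonal_nbhd_def)
  obtain N \<epsilon> where \<epsilon>: "\<epsilon> > 0" "\<And>a b. \<lbrakk>a \<in> A; b \<in> A; \<forall>k<N. \<bar>a k - b k\<bar> < \<epsilon>\<rbrakk> \<Longrightarrow> (a, b) \<in> U"
    using compact_nbhd_of_diagonal[OF A U(1,2)] by metis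
  obtain M \<delta> where \<delta>: "\<delta> > 0" "\<And>a b n. \<lbrakk>a \<in> A; b \<in> A; \<phi> a = \<phi> b; \<forall>k<M. \<bar>a k - b k\<bar> < \<delta>\<rbrakk> \<Longrightarrow>
      \<forall>k<N. \<bar>zpow (top_of_set A) T n a k - zpow (top_of_set A) T n b k\<bar> < \<epsilon>"
    using unif[OF \<epsilon>(1)] by metis
  have "zpow (top_of_set A) T n a \<in> A" if "a \<in> A" for a n
    using zpow_in[of T "top_of_set A"] T that by simp
  then have "(zpow (top_of_set A) T n a, zpow (top_of_set A) T n b) \<in> \<alpha>"
    if "a \<in> A" "b \<in> A" "\<forall>k<M. \<bar>a k - b k\<bar> < \<delta>" "\<phi> a = \<phi> b" for a b n
    using \<epsilon>(2)[OF _ _ \<delta>(2)[OF that(1,2,4,3)]] that(1,2) U(3) by blast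
  then show "\<exists>\<beta>. diagonal_nbhd (top_of_set A) \<beta> \<and> (\<forall>(a, b)\<in>\<beta>. \<phi> a = \<phi> b \<longrightarrow>
      (\<forall>n. (zpow (top_of_set A) T n a, zpow (top_of_set A) T n b) \<in> \<alpha>))"
    by (intro exI[of _ "{(a, b) \<in> A \<times> A. \<forall>k<M. \<bar>a k - b k\<bar> < \<delta>}"] conjI
        coordinatewise_diagonal_nbhd[OF \<delta>(1)]) simp
qed

section \<open>The space\<close>

text \<open>The data \<open>x\<close>, \<open>s\<close>, \<open>z\<close> are interleaved into one real sequence: positions \<open>0\<close> and \<open>1\<close> hold \<open>z\<close>,
  the other even positions the residues and the other odd positions the symbols.  On the set of points
  defined below, convergence of sequences of points is then convergence of \<open>z\<close> together with eventual
  constancy of each residue and each symbol.\<close>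

definition point :: "(nat \<Rightarrow> int) \<Rightarrow> (int \<Rightarrow> real) \<Rightarrow> complex \<Rightarrow> nat \<Rightarrow> real" where
  "point x s z n = (if n = 0 then Re z else if n = 1 then Im z
     else if even n then of_int (x ((n - 2) div 2)) else s (int_decode ((n - 3) div 2)))"

definition residue :: "(nat \<Rightarrow> real) \<Rightarrow> nat \<Rightarrow> int" where
  "residue g i = \<lfloor>g (2 * i + 2)\<rfloor>"

definition symbol :: "(nat \<Rightarrow> real) \<Rightarrow> int \<Rightarrow> real" where
  "symbol g k = g (2 * int_encode k + 3)"

definition phase :: "(nat \<Rightarrow> real) \<Rightarrow> complex" where
  "phase g = Complex (g 0) (g 1)"

lemma residue_point [simp]: "residue (point x s z) = x"
  by (simp add: residue_def point_def fun_eq_iff)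

lemma symbol_point [simp]: "symbol (point x s z) = s"
  by (simp add: symbol_def point_def fun_eq_iff)

lemma phase_point [simp]: "phase (point x s z) = z"
  by (simp add: phase_def point_def complex_eq_iff)

lemma point_eq_iff: "point x s z = point x' s' z' \<longleftrightarrow> x = x' \<and> s = s' \<and> z = z'"
  by (metis residue_point symbol_point phase_point)

text \<open>The inverse limit of the rings of integers modulo \<open>2 ^ i\<close>.\<close>

definition odometer :: "(nat \<Rightarrow> int) set" where
  "odometer = {x. \<forall>i. 0 \<le> x i \<and> x i < 2 ^ i \<and> x (Suc i) mod 2 ^ i = x i}"

text \<open>The congruence says that \<open>x + k\<close> has valuation \<open>i\<close>.\<close>

definition coherent :: "(nat \<Rightarrow> int) \<Rightarrow> (int \<Rightarrow> real) \<Rightarrow> bool" where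
  "coherent x s \<longleftrightarrow> (\<forall>k. s k \<in> {0, 1} \<and>
     (\<forall>i. (x (Suc i) + k) mod 2 ^ Suc i = 2 ^ i \<longrightarrow> s k = of_bool (odd i)))"

definition carrier_set :: "(nat \<Rightarrow> real) set" where
  "carrier_set = {point x s z | x s z. x \<in> odometer \<and> coherent x s \<and> cmod z = 1}"

lemma carrier_setE:
  assumes "g \<in> carrier_set"
  obtains x s z where "g = point x s z" "x \<in> odometer" "coherent x s" "cmod z = 1"
  using assms by (auto simp: carrier_set_def)

lemma point_in_carrier [simp]:
  "point x s z \<in> carrier_set \<longleftrightarrow> x \<in> odometer \<and> coherent x s \<and> cmod z = 1"
  by (auto simp: carrier_set_def point_eq_iff)

lemma carrier_set_iff:
  "g \<in> carrier_set \<longleftrightarrow> g = point (residue g) (symbol g) (phase g) \<and>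
     residue g \<in> odometer \<and> coherent (residue g) (symbol g) \<and> cmod (phase g) = 1"
  by (metis carrier_setE point_in_carrier residue_point symbol_point phase_point)

lemma carrier_eqI:
  assumes "a \<in> carrier_set" "b \<in> carrier_set"
    and "residue a = residue b" "symbol a = symbol b" "phase a = phase b"
  shows "a = b"
  using assms by (metis carrier_set_iff)

subsection \<open>Arithmetic of the odometer\<close>

lemma odometer_mod_self: "x \<in> odometer \<Longrightarrow> x i mod 2 ^ i = x i"
  by (simp add: odometer_def)

lemma odometer_mod:
  assumes x: "x \<in> odometer" and "j \<le> i"
  shows "x i mod 2 ^ j = x j"
  using \<open>j \<le> i\<close>
proof (induction i rule: dec_induct)
  case base
  then show ?case using x by (rule odometer_mod_self)
next
  case (step i)
  have "x (Suc i) mod 2 ^ j = x (Suc i) mod 2 ^ i mod 2 ^ j"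
    using step by (simp add: mod_mod_cancel le_imp_power_dvd)
  then show ?case
    using x step by (simp add: odometer_def)
qed

lemma odometer_add_mod:
  assumes "x \<in> odometer" "j \<le> i"
  shows "(x i + k) mod 2 ^ j = (x j + k) mod 2 ^ j"
  using odometer_mod[OF assms] by (metis mod_add_left_eq)

lemma odometer_translate:
  assumes "x \<in> odometer"
  shows "(\<lambda>i. (x i + n) mod 2 ^ i) \<in> odometer"
proof -
  have "(x (Suc i) + n) mod 2 ^ Suc i mod 2 ^ i = (x i + n) mod 2 ^ i" for i
    using odometer_add_mod[OF assms, of i "Suc i" n]
    by (metis mod_mod_cancel le_imp_power_dvd lessI less_imp_le)
  then show ?thesis
    by (simp add: odometer_def)
qed

lemma level_unique:
  assumes x: "x \<in> odometer" and i: "(x (Suc i) + k) mod 2 ^ Suc i = 2 ^ i"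
    and j: "(x (Suc j) + k) mod 2 ^ Suc j = 2 ^ j"
  shows "i = j"
proof -
  have less: False if "(x (Suc i) + k) mod 2 ^ Suc i = 2 ^ i" "(x (Suc j) + k) mod 2 ^ Suc j = 2 ^ j" "i < j"
    for i j
  proof -
    have "(x (Suc i) + k) mod 2 ^ Suc i = (x (Suc j) + k) mod 2 ^ Suc i"
      using odometer_add_mod[OF x, of "Suc i" "Suc j" k] that(3) by simp
    also have "\<dots> = (x (Suc j) + k) mod 2 ^ Suc j mod 2 ^ Suc i"
      using that(3) by (subst mod_mod_cancel) (auto intro!: le_imp_power_dvd)
    also have "\<dots> = 0"
      unfolding that(2) using that(3) by (simp add: le_imp_power_dvd flip: dvd_eq_mod_eq_0 del: power_Suc)
    finally show False
      using that(1) by simp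
  qed
  show ?thesis
    by (cases i j rule: linorder_cases) (use less[OF i j] less[OF j i] in blast)+
qed

text \<open>Induction on \<open>i\<close>: if \<open>x + k\<close> vanishes modulo \<open>2 ^ i\<close>, it is \<open>0\<close> or \<open>2 ^ i\<close> modulo
  \<open>2 ^ Suc i\<close>, and the second case is excluded.\<close>

lemma level_exists:
  assumes x: "x \<in> odometer" and none: "\<And>i. (x (Suc i) + k) mod 2 ^ Suc i \<noteq> 2 ^ i"
  shows "(x i + k) mod 2 ^ i = 0"
proof (induction i)
  case 0
  then show ?case by simp
next
  case (Suc i)
  define m where "m = (x (Suc i) + k) mod 2 ^ Suc i"
  have "m mod 2 ^ i = 0"
    using odometer_add_mod[OF x, of i "Suc i" k] Suc
    by (simp add: m_def mod_mod_cancel le_imp_power_dvd)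
  then obtain q where q: "m = 2 ^ i * q"
    by (auto simp: dvd_def mod_0_imp_dvd elim: dvdE)
  have "0 \<le> m" "m < 2 ^ Suc i"
    by (simp_all add: m_def)
  then have "0 \<le> q" "q < 2"
    by (auto simp: q zero_le_mult_iff)
  then have "q = 0 \<or> q = 1"
    by auto
  then show ?case
    using none[of i] q by (auto simp: m_def)
qed

lemma zero_translate_unique:
  assumes x: "x \<in> odometer" and "\<And>i. (x i + k) mod 2 ^ i = 0" "\<And>i. (x i + l) mod 2 ^ i = 0"
  shows "k = l"
proof (rule ccontr)
  assume "k \<noteq> l"
  define i where "i = nat \<bar>k - l\<bar>"
  have "(2::int) ^ i dvd (x i + k) - (x i + l)"
    using assms(2,3)[of i] by (intro dvd_diff) (auto simp: dvd_eq_mod_eq_0)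
  then have "(2::int) ^ i \<le> \<bar>k - l\<bar>"
    using \<open>k \<noteq> l\<close> by (metis add_diff_cancel_left dvd_abs_iff dvd_imp_le_int eq_iff_diff_eq_0 abs_power2
        zdvd_imp_le zero_less_abs_iff)
  moreover have "\<bar>k - l\<bar> < 2 ^ i"
    using of_nat_less_two_power[of i, where ?'a = int] by (simp add: i_def)
  ultimately show False by simp
qed

text \<open>The coherent sequence over \<open>x\<close>, with \<open>e\<close> put at the position where \<open>x + k\<close> vanishes.\<close>

definition filled :: "(nat \<Rightarrow> int) \<Rightarrow> real \<Rightarrow> int \<Rightarrow> real" where
  "filled x e k = (if \<exists>i. (x (Suc i) + k) mod 2 ^ Suc i = 2 ^ i
     then of_bool (odd (THE i. (x (Suc i) + k) mod 2 ^ Suc i = 2 ^ i)) else e)"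

lemma filled_coherent:
  assumes "x \<in> odometer" "e \<in> {0, 1}"
  shows "coherent x (filled x e)"
proof -
  have "filled x e k = of_bool (odd i)" if "(x (Suc i) + k) mod 2 ^ Suc i = 2 ^ i" for i k
  proof -
    have "(THE i. (x (Suc i) + k) mod 2 ^ Suc i = 2 ^ i) = i"
      using level_unique[OF assms(1)] that by blast
    then show ?thesis
      using that by (auto simp: filled_def)
  qed
  then show ?thesis
    using assms(2) by (auto simp: coherent_def filled_def)
qed

lemma coherent_eq:
  assumes x: "x \<in> odometer" and "coherent x s" "coherent x t" and k: "\<exists>i. (x i + k) mod 2 ^ i \<noteq> 0"
  shows "s k = t k"
  using level_exists[OF x, of k] assms(2,3) k unfolding coherent_def by metis

subsection \<open>The homeomorphism\<close>

definition valuation :: "(nat \<Rightarrow> int) \<Rightarrow> nat" where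
  "valuation x = (LEAST i. x (Suc i) \<noteq> 0)"

text \<open>Any positive null sequence with divergent sum would do; the partial sums of this one are
  \<open>sqrt m\<close>.\<close>

definition jump :: "nat \<Rightarrow> real" where
  "jump i = sqrt (real (Suc i)) - sqrt (real i)"

text \<open>Among the points \<open>x = n\<close> of the orbit of \<open>0\<close>, the symbol that is read here is the free one
  precisely if \<open>n = 2 ^ v\<close>.\<close>

definition twist :: "(nat \<Rightarrow> int) \<Rightarrow> (int \<Rightarrow> real) \<Rightarrow> real" where
  "twist x s = (if \<forall>i. x i = 0 then 0 else jump (valuation x) * s (- (2 ^ valuation x)))"

definition step :: "(nat \<Rightarrow> real) \<Rightarrow> nat \<Rightarrow> real" where
  "step g = point (\<lambda>i. (residue g i + 1) mod 2 ^ i) (\<lambda>k. symbol g (k + 1))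
     (phase g * cis (twist (residue g) (symbol g)))"

definition unstep :: "(nat \<Rightarrow> real) \<Rightarrow> nat \<Rightarrow> real" where
  "unstep g = (let x = (\<lambda>i. (residue g i - 1) mod 2 ^ i); s = (\<lambda>k. symbol g (k - 1))
     in point x s (phase g * cis (- twist x s)))"

lemma coherent_translate:
  assumes x: "x \<in> odometer" and s: "coherent x s"
  shows "coherent (\<lambda>i. (x i + n) mod 2 ^ i) (\<lambda>k. s (k + n))"
proof -
  have "((x (Suc i) + n) mod 2 ^ Suc i + k) mod 2 ^ Suc i = (x (Suc i) + (k + n)) mod 2 ^ Suc i" for i k
    unfolding mod_add_left_eq by (simp only: ac_simps)
  then show ?thesis
    using s unfolding coherent_def by simp
qed

lemma step_in [simp]: "g \<in> carrier_set \<Longrightarrow> step g \<in> carrier_set"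
  using odometer_translate[of "residue g" 1] coherent_translate[of "residue g" "symbol g" 1]
  by (simp add: step_def carrier_set_iff[of g] norm_mult)

lemma unstep_in [simp]: "g \<in> carrier_set \<Longrightarrow> unstep g \<in> carrier_set"
  using odometer_translate[of "residue g" "-1"] coherent_translate[of "residue g" "symbol g" "-1"]
  by (simp add: unstep_def carrier_set_iff[of g] norm_mult Let_def)

lemma step_unstep:
  assumes g: "g \<in> carrier_set"
  shows "step (unstep g) = g"
proof (rule carrier_eqI)
  show "step (unstep g) \<in> carrier_set"
    using g by (intro step_in unstep_in)
  have x: "residue g \<in> odometer"
    using g by (simp add: carrier_set_iff[of g])
  show "residue (step (unstep g)) = residue g"
    using odometer_mod_self[OF x]
    by (simp add: step_def unstep_def Let_def fun_eq_iff mod_add_left_eq)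
qed (use g in \<open>simp_all add: step_def unstep_def Let_def mult.assoc cis_mult\<close>)

lemma unstep_step: "g \<in> carrier_set \<Longrightarrow> unstep (step g) = g"
proof -
  assume g: "g \<in> carrier_set"
  then have x: "residue g \<in> odometer"
    by (simp add: carrier_set_iff[of g])
  then have "(\<lambda>i. ((residue g i + 1) mod 2 ^ i - 1) mod 2 ^ i) = residue g"
    using odometer_mod_self[OF x] by (simp add: fun_eq_iff mod_diff_left_eq)
  then show ?thesis
    using g by (simp add: step_def unstep_def Let_def mult.assoc cis_mult carrier_set_iff[of g, symmetric])
       (metis carrier_set_iff)
qed

lemma bij_betw_step: "bij_betw step carrier_set carrier_set"
  by (rule bij_betwI[where g = unstep]) (auto simp: step_unstep unstep_step)

subsection \<open>Convergence in the space\<close>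

lemma tendsto_Ints_eventually_eq:
  fixes f :: "'a \<Rightarrow> real"
  assumes "(f \<longlongrightarrow> l) F" "\<forall>\<^sub>F n in F. f n \<in> \<int>" "F \<noteq> bot"
  shows "l \<in> \<int> \<and> (\<forall>\<^sub>F n in F. f n = l)"
proof -
  have l: "l \<in> \<int>"
    using Lim_in_closed_set[OF closed_Ints assms(2,3,1)] .
  have "\<forall>\<^sub>F n in F. dist (f n) l < 1"
    using assms(1) by (rule tendstoD) simp
  then have "\<forall>\<^sub>F n in F. f n = l"
    using assms(2)
  proof eventually_elim
    case (elim n)
    then show ?case
      using l by (auto simp: dist_real_def Ints_def)
  qed
  with l show ?thesis by blast
qed

lemma point_tendsto:
  assumes x: "\<And>i. \<forall>\<^sub>F n in F. x n i = x' i" and s: "\<And>k. \<forall>\<^sub>F n in F. s n k = s' k"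
    and z: "(z \<longlongrightarrow> z') F"
  shows "((\<lambda>n. point (x n) (s n) (z n)) \<longlongrightarrow> point x' s' z') F"
  unfolding tendsto_coordinatewise
proof
  fix k
  show "((\<lambda>n. point (x n) (s n) (z n) k) \<longlongrightarrow> point x' s' z' k) F"
  proof (cases "k \<le> 1")
    case True
    then have "k = 0 \<or> k = 1" by auto
    then show ?thesis
      using tendsto_Re[OF z] tendsto_Im[OF z] by (auto simp: point_def)
  next
    case False
    have "\<forall>\<^sub>F n in F. point (x n) (s n) (z n) k = point x' s' z' k"
      using x[of "(k - 2) div 2"] s[of "int_decode ((k - 3) div 2)"]
      by eventually_elim (use False in \<open>auto simp: point_def\<close>)
    then show ?thesis
      by (rule tendsto_eventually)
  qed
qed

lemma carrier_residue_coordinate: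
  "g \<in> carrier_set \<Longrightarrow> g (2 * i + 2) = of_int (residue g i)"
  by (subst carrier_set_iff[THEN iffD1, THEN conjunct1]) (simp_all add: point_def)

lemma carrier_symbol: "g \<in> carrier_set \<Longrightarrow> symbol g k \<in> {0, 1}"
  by (auto simp: carrier_set_iff coherent_def)

lemma carrier_tendstoD:
  assumes lim: "(f \<longlongrightarrow> l) F" and f: "\<And>n. f n \<in> carrier_set" and F: "F \<noteq> bot"
  shows "\<And>i. \<forall>\<^sub>F n in F. residue (f n) i = residue l i" "\<And>i. l (2 * i + 2) = of_int (residue l i)"
    "\<And>k. \<forall>\<^sub>F n in F. symbol (f n) k = symbol l k"
    "((\<lambda>n. phase (f n)) \<longlongrightarrow> phase l) F"
proof -
  have co: "((\<lambda>n. f n k) \<longlongrightarrow> l k) F" for k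
    using lim by (simp add: tendsto_coordinatewise)
  show "\<forall>\<^sub>F n in F. residue (f n) i = residue l i" "l (2 * i + 2) = of_int (residue l i)" for i
  proof -
    have "l (2 * i + 2) \<in> \<int> \<and> (\<forall>\<^sub>F n in F. f n (2 * i + 2) = l (2 * i + 2))"
      by (rule tendsto_Ints_eventually_eq[OF co _ F])
        (simp add: carrier_residue_coordinate[OF f] del: add_2_eq_Suc')
    then show "\<forall>\<^sub>F n in F. residue (f n) i = residue l i" "l (2 * i + 2) = of_int (residue l i)"
      by (auto simp: residue_def elim!: eventually_mono Ints_cases simp del: add_2_eq_Suc')
  qed
  show "\<forall>\<^sub>F n in F. symbol (f n) k = symbol l k" for k
  proof -
    have "symbol (f n) k \<in> \<int>" for n
      using carrier_symbol[OF f, of n k] by auto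
    then show ?thesis
      using tendsto_Ints_eventually_eq[OF co[of "2 * int_encode k + 3"] _ F]
      by (simp add: symbol_def)
  qed
  show "((\<lambda>n. phase (f n)) \<longlongrightarrow> phase l) F"
    unfolding phase_def by (intro tendsto_Complex co)
qed

text \<open>Every condition on the residues and symbols involves finitely many of them, and along a convergent
  sequence these are eventually constant.\<close>

lemma closed_carrier: "closed carrier_set"
  unfolding closed_sequential_limits
proof (intro allI impI, elim conjE)
  fix f l assume f: "\<forall>n. f n \<in> carrier_set" and lim: "f \<longlonglongrightarrow> l"
  note D = carrier_tendstoD[OF lim spec[OF f] sequentially_bot]
  have fn: "residue (f n) \<in> odometer" "coherent (residue (f n)) (symbol (f n))" "cmod (phase (f n)) = 1" for n
    using f by (auto simp: carrier_set_iff)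
  have "residue l \<in> odometer"
  proof -
    have "0 \<le> residue l i \<and> residue l i < 2 ^ i \<and> residue l (Suc i) mod 2 ^ i = residue l i" for i
    proof -
      have "\<forall>\<^sub>F n in sequentially. 0 \<le> residue l i \<and> residue l i < 2 ^ i \<and> residue l (Suc i) mod 2 ^ i = residue l i"
        using D(1)[of i] D(1)[of "Suc i"]
      proof eventually_elim
        case (elim n)
        then show ?case
          using fn(1)[of n] by (auto simp: odometer_def dest: spec[of _ i])
      qed
      then show ?thesis by simp
    qed
    then show ?thesis by (simp add: odometer_def)
  qed
  moreover have "coherent (residue l) (symbol l)"
    unfolding coherent_def
  proof (intro allI conjI impI)
    fix k
    have "\<forall>\<^sub>F n in sequentially. symbol l k \<in> {0, 1}"
      using D(3)[of k] by eventually_elim (use carrier_symbol f in metis)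
    then show "symbol l k \<in> {0, 1}" by simp
    fix i assume i: "(residue l (Suc i) + k) mod 2 ^ Suc i = 2 ^ i"
    have "\<forall>\<^sub>F n in sequentially. symbol l k = of_bool (odd i)"
      using D(3)[of k] D(1)[of "Suc i"]
    proof eventually_elim
      case (elim n)
      then show ?case
        using fn(2)[of n] i unfolding coherent_def by metis
    qed
    then show "symbol l k = of_bool (odd i)" by simp
  qed
  moreover have "cmod (phase l) = 1"
    using tendsto_norm[OF D(4)] fn(3) by (simp add: LIMSEQ_const_iff)
  moreover have "l = point (residue l) (symbol l) (phase l)"
  proof
    fix n :: nat
    consider "n = 0" | "n = 1" | i where "n = 2 * i + 2" | i where "n = 2 * i + 3"
    proof -
      assume a: "n = 0 \<Longrightarrow> thesis" "n = 1 \<Longrightarrow> thesis" "\<And>i. n = 2 * i + 2 \<Longrightarrow> thesis" "\<And>i. n = 2 * i + 3 \<Longrightarrow> thesis"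
      show thesis
      proof (cases "n \<le> 1")
        case True then show ?thesis using a(1,2) by linarith
      next
        case False
        then show ?thesis
          using a(3)[of "(n - 2) div 2"] a(4)[of "(n - 3) div 2"] by (cases "even n") (auto elim!: evenE oddE)
      qed
    qed
    then show "l n = point (residue l) (symbol l) (phase l) n"
      by cases (use D(2) in \<open>auto simp: point_def phase_def symbol_def\<close>)
  qed
  ultimately show "l \<in> carrier_set"
    using carrier_set_iff by blast
qed

lemma compact_carrier: "compact carrier_set"
proof -
  have bound: "\<bar>g n\<bar> \<le> 2 ^ n" if g: "g \<in> carrier_set" for g n
  proof -
    from g obtain x s z where p: "g = point x s z" "x \<in> odometer" "coherent x s" "cmod z = 1"
      by (rule carrier_setE)
    have one: "(1::real) \<le> 2 ^ n"
      by simp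
    have "\<bar>Re z\<bar> \<le> 2 ^ n" "\<bar>Im z\<bar> \<le> 2 ^ n"
      using order_trans[OF abs_Re_le_cmod[of z]] order_trans[OF abs_Im_le_cmod[of z]] one p(4)
      by simp_all
    moreover have "\<bar>s k\<bar> \<le> 2 ^ n" for k
    proof -
      have "\<bar>s k\<bar> \<le> 1"
        using p(3) unfolding coherent_def by (auto dest: spec[of _ k])
      then show ?thesis
        using one by (rule order_trans)
    qed
    moreover have "\<bar>real_of_int (x ((n - 2) div 2))\<bar> \<le> 2 ^ n"
    proof -
      have "0 \<le> x ((n - 2) div 2)" "x ((n - 2) div 2) < 2 ^ ((n - 2) div 2)"
        using p(2) by (auto simp: odometer_def)
      then have "\<bar>real_of_int (x ((n - 2) div 2))\<bar> \<le> 2 ^ ((n - 2) div 2)"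
        by (simp add: less_imp_le)
      also have "\<dots> \<le> 2 ^ n"
        by (rule power_increasing) auto
      finally show ?thesis .
    qed
    ultimately show ?thesis
      unfolding p(1) point_def using one by (auto simp del: One_nat_def)
  qed
  define B where "B = (\<Pi>\<^sub>E n\<in>UNIV. {- (2 ^ n) .. 2 ^ n :: real})"
  have "compactin (product_topology (\<lambda>_. euclidean) (UNIV :: nat set)) B"
    unfolding B_def compactin_PiE by simp
  then have "compact B"
    by (simp add: euclidean_product_topology)
  moreover have "carrier_set \<subseteq> B"
    using bound by (auto simp: B_def abs_le_iff minus_le_iff)
  ultimately show ?thesis
    using compact_Int_closed[OF _ closed_carrier, of B] by (simp add: inf.absorb2)
qed

subsection \<open>Valuation and continuity\<close>

lemma odometer_zero_below:
  assumes "x \<in> odometer" "x i = 0" "j \<le> i"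
  shows "x j = 0"
  using odometer_mod[OF assms(1,3)] assms(2) by simp

lemma odometer_0 [simp]: "x \<in> odometer \<Longrightarrow> x 0 = 0"
  by (auto simp: odometer_def dest: spec[of _ 0])

lemma valuation_eqI:
  assumes "x \<in> odometer" "x v = 0" "x (Suc v) \<noteq> 0"
  shows "valuation x = v"
  unfolding valuation_def
proof (rule Least_equality)
  show "v \<le> i" if "x (Suc i) \<noteq> 0" for i
    using that odometer_zero_below[OF assms(1,2), of "Suc i"] by (meson not_less_eq_eq)
qed (rule assms(3))

lemma valuation_props:
  assumes x: "x \<in> odometer" and ne: "\<not> (\<forall>i. x i = 0)"
  shows "x (valuation x) = 0" "x (Suc (valuation x)) \<noteq> 0"
proof -
  obtain i where i: "x i \<noteq> 0"
    using ne by blast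
  then obtain j where "i = Suc j"
    using odometer_0[OF x] by (cases i) auto
  then show v: "x (Suc (valuation x)) \<noteq> 0"
    unfolding valuation_def using i LeastI[of "\<lambda>i. x (Suc i) \<noteq> 0" j] by simp
  show "x (valuation x) = 0"
  proof (cases "valuation x")
    case (Suc w)
    then show ?thesis
      using not_less_Least[of w "\<lambda>i. x (Suc i) \<noteq> 0"] by (auto simp: valuation_def)
  qed (use x in simp)
qed

lemma jump_nonneg: "0 \<le> jump i"
  by (simp add: jump_def)

lemma jump_tendsto_0: "jump \<longlonglongrightarrow> 0"
  unfolding jump_def by real_asymp

lemma sum_jump: "(\<Sum>i<m. jump i) = sqrt (real m)"
  by (induction m) (simp_all add: jump_def)

text \<open>The only critical points are those with \<open>x = 0\<close>: there the valuation of nearby points tends to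
  infinity and the twist is bounded by \<open>jump\<close> of the valuation.  Elsewhere the valuation, and with it the
  twist, is locally constant.\<close>

lemma twist_tendsto:
  assumes lim: "f \<longlonglongrightarrow> l" and f: "\<And>n. f n \<in> carrier_set" and l: "l \<in> carrier_set"
  shows "(\<lambda>n. twist (residue (f n)) (symbol (f n))) \<longlonglongrightarrow> twist (residue l) (symbol l)"
proof -
  note D = carrier_tendstoD[OF lim f sequentially_bot]
  have x: "residue l \<in> odometer" "\<And>n. residue (f n) \<in> odometer"
    using l f by (simp_all add: carrier_set_iff)
  show ?thesis
  proof (cases "\<forall>i. residue l i = 0")
    case True
    have "(\<lambda>n. twist (residue (f n)) (symbol (f n))) \<longlonglongrightarrow> 0"
    proof (rule LIMSEQ_I)
      fix \<epsilon> :: real assume "\<epsilon> > 0"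
      then obtain N where N: "\<And>i. i \<ge> N \<Longrightarrow> norm (jump i - 0) < \<epsilon>"
        using LIMSEQ_D[OF jump_tendsto_0] by blast
      have "\<forall>\<^sub>F n in sequentially. norm (twist (residue (f n)) (symbol (f n)) - 0) < \<epsilon>"
        using D(1)[of N]
      proof eventually_elim
        case (elim n)
        show ?case
        proof (cases "\<forall>i. residue (f n) i = 0")
          case False
          have "N \<le> valuation (residue (f n))"
            using odometer_zero_below[OF x(2)[of n], of N "Suc (valuation (residue (f n)))"]
              valuation_props(2)[OF x(2) False] elim True by (metis not_less_eq_eq)
          then have "jump (valuation (residue (f n))) < \<epsilon>"
            using N jump_nonneg by fastforce
          moreover have "symbol (f n) (- (2 ^ valuation (residue (f n)))) \<in> {0, 1}"
            by (rule carrier_symbol[OF f])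
          moreover have "twist (residue (f n)) (symbol (f n))
              = jump (valuation (residue (f n))) * symbol (f n) (- (2 ^ valuation (residue (f n))))"
            using False unfolding twist_def by (rule if_not_P)
          ultimately show ?thesis
            using \<open>\<epsilon> > 0\<close> jump_nonneg[of "valuation (residue (f n))"] by auto
        qed (use \<open>\<epsilon> > 0\<close> in \<open>simp add: twist_def\<close>)
      qed
      then show "\<exists>no. \<forall>n\<ge>no. norm (twist (residue (f n)) (symbol (f n)) - 0) < \<epsilon>"
        by (simp add: eventually_sequentially)
    qed
    then show ?thesis
      using True by (simp add: twist_def)
  next
    case False
    define v where "v = valuation (residue l)"
    have "\<forall>\<^sub>F n in sequentially. twist (residue (f n)) (symbol (f n)) = twist (residue l) (symbol l)"
      using D(1)[of v] D(1)[of "Suc v"] D(3)[of "- (2 ^ v)"]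
    proof eventually_elim
      case (elim n)
      then have *: "residue (f n) v = 0" "residue (f n) (Suc v) \<noteq> 0"
        using valuation_props[OF x(1) False] by (simp_all add: v_def)
      then have "valuation (residue (f n)) = v" "\<not> (\<forall>i. residue (f n) i = 0)"
        using valuation_eqI[OF x(2)] by blast+
      then show ?case
        unfolding twist_def if_not_P[OF False] using elim by (simp only: if_not_P v_def if_False)
    qed
    then show ?thesis
      by (rule tendsto_eventually)
  qed
qed

lemma continuous_on_step: "continuous_on carrier_set step"
  unfolding continuous_on_sequentially
proof (intro ballI allI impI, elim conjE)
  fix f l assume l: "l \<in> carrier_set" and f: "\<forall>n. f n \<in> carrier_set" and lim: "f \<longlonglongrightarrow> l"
  note D = carrier_tendstoD[OF lim spec[OF f] sequentially_bot]
  show "(step \<circ> f) \<longlonglongrightarrow> step l"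
    unfolding o_def step_def
  proof (rule point_tendsto)
    show "\<forall>\<^sub>F n in sequentially. (residue (f n) i + 1) mod 2 ^ i = (residue l i + 1) mod 2 ^ i" for i
      using D(1)[of i] by eventually_elim simp
    show "\<forall>\<^sub>F n in sequentially. symbol (f n) (k + 1) = symbol l (k + 1)" for k
      by (rule D(3))
    show "(\<lambda>n. phase (f n) * cis (twist (residue (f n)) (symbol (f n))))
        \<longlonglongrightarrow> phase l * cis (twist (residue l) (symbol l))"
      by (intro tendsto_intros D(4) tendsto_cis twist_tendsto lim l spec[OF f])
  qed
qed

subsection \<open>Iterates and rotations\<close>

abbreviation flow_space :: "(nat \<Rightarrow> real) topology" where
  "flow_space \<equiv> top_of_set carrier_set"

abbreviation iter :: "int \<Rightarrow> (nat \<Rightarrow> real) \<Rightarrow> nat \<Rightarrow> real" where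
  "iter \<equiv> zpow flow_space step"

lemma compact_Hausdorff_space: "compact_space flow_space" "Hausdorff_space flow_space"
  by (simp_all add: compact_space_subtopology compact_carrier Hausdorff_space_subtopology)

lemma homeomorphic_map_step: "homeomorphic_map flow_space flow_space step"
proof (rule continuous_imp_homeomorphic_map)
  show "continuous_map flow_space flow_space step"
    using continuous_on_step by auto
qed (use compact_Hausdorff_space bij_betw_step in \<open>auto simp: bij_betw_def\<close>)

lemma cascade_space: "cascade flow_space step"
  by (simp add: cascade_def compact_Hausdorff_space homeomorphic_map_step)

lemma bij_step: "bij_betw step (topspace flow_space) (topspace flow_space)"
  using bij_betw_step by simp

lemma iter_in [simp]: "g \<in> carrier_set \<Longrightarrow> iter n g \<in> carrier_set"
  using zpow_in[OF bij_step, of g n] by simp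

lemma iter_plus1: "g \<in> carrier_set \<Longrightarrow> iter (n + 1) g = step (iter n g)"
  using zpow_plus1[OF bij_step, of g n] by simp

lemma iter_add: "g \<in> carrier_set \<Longrightarrow> iter (m + n) g = iter m (iter n g)"
  using zpow_add[OF bij_step, of g m n] by simp

lemma residue_iter:
  assumes g: "g \<in> carrier_set"
  shows "residue (iter n g) i = (residue g i + n) mod 2 ^ i"
proof -
  have m: "residue (iter n g) i mod 2 ^ i = residue (iter n g) i" for n
    using iter_in[OF g, of n] odometer_mod_self by (simp add: carrier_set_iff)
  have s: "residue (iter (n + 1) g) i = (residue (iter n g) i + 1) mod 2 ^ i" for n
    by (simp add: iter_plus1[OF g] step_def)
  show ?thesis
  proof (induction n rule: int_induct[where k = 0])
    case base
    then show ?case using m[of 0] by simp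
  next
    case (step1 n)
    then show ?case by (simp only: s mod_add_left_eq add.assoc)
  next
    case (step2 n)
    have "residue (iter (n - 1) g) i = ((residue (iter (n - 1) g) i + 1) mod 2 ^ i - 1) mod 2 ^ i"
      by (simp add: mod_diff_left_eq m)
    also have "\<dots> = ((residue g i + n) mod 2 ^ i - 1) mod 2 ^ i"
      using s[of "n - 1"] step2 by simp
    also have "\<dots> = (residue g i + (n - 1)) mod 2 ^ i"
      by (simp add: mod_diff_left_eq add_diff_eq)
    finally show ?case .
  qed
qed

lemma symbol_iter:
  assumes g: "g \<in> carrier_set"
  shows "symbol (iter n g) k = symbol g (k + n)"
proof -
  have s: "symbol (iter (n + 1) g) k = symbol (iter n g) (k + 1)" for n k
    by (simp add: iter_plus1[OF g] step_def)
  show ?thesis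
  proof (induction n arbitrary: k rule: int_induct[where k = 0])
    case base
    then show ?case by simp
  next
    case (step1 n)
    then show ?case by (simp only: s) (simp add: ac_simps)
  next
    case (step2 n)
    then show ?case using s[of "n - 1" "k - 1"] by (simp add: algebra_simps)
  qed
qed

definition spin :: "complex \<Rightarrow> (nat \<Rightarrow> real) \<Rightarrow> nat \<Rightarrow> real" where
  "spin c g = point (residue g) (symbol g) (c * phase g)"

lemma spin_coords [simp]:
  "residue (spin c g) = residue g" "symbol (spin c g) = symbol g" "phase (spin c g) = c * phase g"
  by (simp_all add: spin_def)

lemma spin_in [simp]: "\<lbrakk>g \<in> carrier_set; cmod c = 1\<rbrakk> \<Longrightarrow> spin c g \<in> carrier_set"
  by (simp add: spin_def carrier_set_iff[of g] norm_mult)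

lemma spin_spin: "spin c (spin d g) = spin (c * d) g"
  by (simp add: spin_def mult.assoc)

lemma spin_1: "g \<in> carrier_set \<Longrightarrow> spin 1 g = g"
  by (simp add: spin_def carrier_set_iff[of g, symmetric]) (metis carrier_set_iff)

lemma spin_step: "spin c (step g) = step (spin c g)"
  by (simp add: spin_def step_def mult.assoc)

lemma spin_cancel:
  assumes "g \<in> carrier_set" "spin c g = spin d g"
  shows "c = d"
proof -
  have "c * phase g = d * phase g"
    using assms(2) by (metis spin_coords(3))
  moreover have "phase g \<noteq> 0"
    using assms(1) by (auto simp: carrier_set_iff)
  ultimately show ?thesis by simp
qed

lemma same_fibre_spin:
  assumes "a \<in> carrier_set" "b \<in> carrier_set" "residue a = residue b" "symbol a = symbol b"
  obtains d where "cmod d = 1" "b = spin d a"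
proof
  have "cmod (phase a) = 1" "cmod (phase b) = 1"
    using assms by (simp_all add: carrier_set_iff)
  then show d: "cmod (phase b / phase a) = 1" and "b = spin (phase b / phase a) a"
    using assms by (auto intro!: carrier_eqI simp: norm_divide)
qed

lemma spin_tendsto:
  assumes lim: "f \<longlonglongrightarrow> l" and f: "\<And>n. f n \<in> carrier_set"
  shows "(\<lambda>n. spin c (f n)) \<longlonglongrightarrow> spin c l"
  unfolding spin_def
  by (intro point_tendsto carrier_tendstoD[OF lim f sequentially_bot] tendsto_intros)

lemma continuous_on_spin: "continuous_on carrier_set (spin c)"
  unfolding continuous_on_sequentially o_def using spin_tendsto by blast

lemma spin_iter:
  assumes "cmod c = 1" "g \<in> carrier_set"
  shows "spin c (iter n g) = iter n (spin c g)"
  by (rule zpow_equivariant[OF bij_step bij_step]) (use assms in \<open>auto simp: spin_step\<close>)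

subsection \<open>The doubled orbit\<close>

definition twin :: "real \<Rightarrow> nat \<Rightarrow> real" where
  "twin e = point (\<lambda>_. 0) (filled (\<lambda>_. 0) e) 1"

lemma zero_odometer: "(\<lambda>_. 0) \<in> odometer"
  by (simp add: odometer_def)

lemma twin_in [simp]: "e \<in> {0, 1} \<Longrightarrow> twin e \<in> carrier_set"
  unfolding twin_def by (simp only: point_in_carrier filled_coherent zero_odometer) simp

lemma twin_coords [simp]:
  "residue (twin e) = (\<lambda>_. 0)" "phase (twin e) = 1" "symbol (twin e) = filled (\<lambda>_. 0) e"
  by (simp_all add: twin_def)

lemma nonzero_mod_power:
  fixes k :: int
  assumes "k \<noteq> 0"
  shows "\<exists>i. k mod 2 ^ i \<noteq> 0"
proof (rule ccontr)
  assume "\<not> ?thesis"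
  then show False
    using zero_translate_unique[OF zero_odometer, of k 0] assms by simp
qed

lemma filled_zero_0 [simp]: "filled (\<lambda>_. 0) e 0 = e"
  by (simp add: filled_def)

lemma filled_zero_eq:
  assumes "k \<noteq> 0" "e \<in> {0, 1}" "e' \<in> {0, 1}"
  shows "filled (\<lambda>_. 0) e k = filled (\<lambda>_. 0) e' k"
  using coherent_eq[OF zero_odometer filled_coherent[OF zero_odometer assms(2)]
      filled_coherent[OF zero_odometer assms(3)], of k] nonzero_mod_power[OF assms(1)] by simp

lemma zero_fibre:
  assumes g: "g \<in> carrier_set" and z: "\<And>i. residue g i = 0"
  shows "g = spin (phase g) (twin (symbol g 0))"
proof (rule carrier_eqI)
  have x: "residue g = (\<lambda>_. 0)"
    using z by auto
  have e: "symbol g 0 \<in> {0, 1}"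
    by (rule carrier_symbol[OF g])
  then show "spin (phase g) (twin (symbol g 0)) \<in> carrier_set"
    using g by (intro spin_in twin_in) (simp_all add: carrier_set_iff)
  show "symbol g = symbol (spin (phase g) (twin (symbol g 0)))"
  proof
    fix k
    have "coherent (\<lambda>_. 0) (symbol g)"
      using g x by (simp add: carrier_set_iff)
    then have "symbol g k = filled (\<lambda>_. 0) (symbol g 0) k" if "k \<noteq> 0"
      using coherent_eq[OF zero_odometer _ filled_coherent[OF zero_odometer e]]
        nonzero_mod_power[OF that] by simp
    then show "symbol g k = symbol (spin (phase g) (twin (symbol g 0))) k"
      by (cases "k = 0") simp_all
  qed
qed (use g in \<open>simp_all add: z fun_eq_iff\<close>)

text \<open>The points with several symbol sequences over the same \<open>x\<close> lie, up to rotations, on the orbits of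
  the twins: if the symbols differ at \<open>k\<close>, then \<open>x = - k\<close>.\<close>

lemma split_fibre:
  assumes a: "a \<in> carrier_set" and b: "b \<in> carrier_set" and x: "residue a = residue b"
    and k: "symbol a k \<noteq> symbol b k"
  obtains e e' c d where "{e, e'} = {0, 1}" "e \<noteq> e'" "cmod c = 1" "cmod d = 1"
    "a = iter (- k) (spin c (twin e))" "b = iter (- k) (spin d (twin e'))"
proof -
  have zero: "(residue a i + k) mod 2 ^ i = 0" for i
    using coherent_eq[of "residue a" "symbol a" "symbol b" k] a b x k
    by (auto simp: carrier_set_iff)
  define a' b' where "a' = iter k a" and "b' = iter k b"
  have C: "a' \<in> carrier_set" "b' \<in> carrier_set"
    using a b by (simp_all add: a'_def b'_def)
  have "a' = spin (phase a') (twin (symbol a k))" "b' = spin (phase b') (twin (symbol b k))"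
    using zero_fibre[OF C(1)] zero_fibre[OF C(2)] a b zero x
    by (simp_all add: a'_def b'_def residue_iter symbol_iter)
  moreover have "iter (- k) a' = a" "iter (- k) b' = b"
    using iter_add[OF a, of "-k" k] iter_add[OF b, of "-k" k] by (simp_all add: a'_def b'_def)
  moreover have "cmod (phase a') = 1" "cmod (phase b') = 1"
    using C by (simp_all add: carrier_set_iff)
  moreover have "{symbol a k, symbol b k} = {0, 1}"
    using carrier_symbol[OF a, of k] carrier_symbol[OF b, of k] k by auto
  ultimately show thesis
    using that[of "symbol a k" "symbol b k" "phase a'" "phase b'"] k by metis
qed

lemma valuation_of_nat:
  fixes n :: nat
  shows "valuation (\<lambda>i. int (2 ^ n) mod 2 ^ i) = n"
  using valuation_eqI[OF odometer_translate[OF zero_odometer, of "2 ^ n"], of n] by simp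

text \<open>Along the orbits of the twins the symbols differ only at the position \<open>- n\<close> at time \<open>n\<close>, and this
  is the position read by the twist if and only if \<open>n\<close> is a power of \<open>2\<close>.\<close>

lemma twist_difference:
  defines "D \<equiv> \<lambda>n e. twist (residue (iter (int n) (twin e))) (symbol (iter (int n) (twin e)))"
  shows "D (2 ^ i) 1 - D (2 ^ i) 0 = jump i"
    and "n \<notin> range (\<lambda>i. 2 ^ i) \<Longrightarrow> D n 1 - D n 0 = 0"
proof -
  have res: "residue (iter (int n) (twin e)) = (\<lambda>i. int n mod 2 ^ i)" if "e \<in> {0, 1}" for n e
    using that by (simp add: residue_iter fun_eq_iff)
  have sym: "symbol (iter (int n) (twin e)) k = filled (\<lambda>_. 0) e (k + int n)" if "e \<in> {0, 1}" for n e k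
    using that by (simp add: symbol_iter)
  define V Z where "V n = valuation (\<lambda>i. int n mod 2 ^ i)" and "Z n \<longleftrightarrow> (\<forall>i. int n mod 2 ^ i = 0)"
    for n
  have D: "D n e = (if Z n then 0 else jump (V n) * filled (\<lambda>_. 0) e (- (2 ^ V n) + int n))"
    if "e \<in> {0, 1}" for n e
    unfolding D_def twist_def res[OF that] sym[OF that] V_def Z_def ..
  have "int (2 ^ i) mod 2 ^ Suc i \<noteq> 0"
    by simp
  then have "\<not> Z (2 ^ i)"
    unfolding Z_def by blast
  then show "D (2 ^ i) 1 - D (2 ^ i) 0 = jump i"
    using valuation_of_nat[of i] by (simp add: D V_def)
  assume n: "n \<notin> range (\<lambda>i. 2 ^ i)"
  have "- (2 ^ V n) + int n \<noteq> 0"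
  proof
    assume "- (2 ^ V n) + int n = 0"
    then have "int n = int (2 ^ V n)" by simp
    then have "n = 2 ^ V n" by (simp only: of_nat_eq_iff)
    then show False using n by blast
  qed
  then have "filled (\<lambda>_. 0) 1 (- (2 ^ V n) + int n) = filled (\<lambda>_. 0) 0 (- (2 ^ V n) + int n)"
    by (intro filled_zero_eq) auto
  then show "D n 1 - D n 0 = 0"
    by (simp add: D)
qed

lemma phase_iter_twins:
  "phase (iter (2 ^ m) (twin 1)) = cis (sqrt (real m)) * phase (iter (2 ^ m) (twin 0))"
proof -
  define D where "D = (\<lambda>n e. twist (residue (iter (int n) (twin e))) (symbol (iter (int n) (twin e))))"
  have ph: "phase (iter (int n) (twin e)) = cis (\<Sum>k<n. D k e)" if "e \<in> {0, 1}" for n e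
  proof (induction n)
    case (Suc n)
    have e: "iter (int (Suc n)) (twin e) = step (iter (int n) (twin e))"
      using iter_plus1[OF twin_in[OF that], of "int n"] by (simp add: algebra_simps)
    show ?case
      unfolding e step_def[of "iter (int n) (twin e)"] using Suc by (simp add: D_def cis_mult)
  qed simp
  have "(\<Sum>k<2 ^ m. D k 1 - D k 0) = (\<Sum>k\<in>(\<lambda>i. 2 ^ i) ` {..<m}. D k 1 - D k 0)"
  proof (rule sum.mono_neutral_right)
    show "\<forall>k\<in>{..<2 ^ m} - (\<lambda>i. 2 ^ i) ` {..<m}. D k 1 - D k 0 = 0"
      using twist_difference(2) by (fastforce simp: D_def)
  qed auto
  also have "\<dots> = (\<Sum>i<m. D (2 ^ i) 1 - D (2 ^ i) 0)"
    by (subst sum.reindex) (auto simp: inj_on_def)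
  also have "\<dots> = sqrt (real m)"
    using twist_difference(1) by (simp add: D_def sum_jump)
  finally have "(\<Sum>k<2 ^ m. D k 1) = sqrt (real m) + (\<Sum>k<2 ^ m. D k 0)"
    by (simp add: sum_subtractf)
  then show ?thesis
    using ph[of 1 "2 ^ m"] ph[of 0 "2 ^ m"] by (simp add: cis_mult)
qed

text \<open>The times are \<open>2 ^ m\<close> with \<open>sqrt m\<close> close to the argument of \<open>c\<close> modulo \<open>2 * pi\<close>.  The residues
  of the twins always agree, and the position at which the symbols differ tends to minus infinity.\<close>

lemma twins_asymptotic:
  assumes c: "cmod c = 1"
  obtains \<nu> :: "nat \<Rightarrow> int" where
    "\<And>k. (\<lambda>j. iter (\<nu> j) (twin 1) k - spin c (iter (\<nu> j) (twin 0)) k) \<longlonglongrightarrow> 0"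
proof -
  obtain \<theta> where \<theta>: "0 \<le> \<theta>" "c = cis \<theta>"
  proof -
    have "c \<noteq> 0" using c by auto
    then have "cis (Arg c + 2 * pi) = c"
      using c by (simp add: cis_Arg sgn_eq flip: cis_mult)
    moreover have "0 \<le> Arg c + 2 * pi"
      using mpi_less_Arg[of c] pi_gt_zero by linarith
    ultimately show thesis
      using that by metis
  qed
  define m where "m j = nat \<lfloor>(\<theta> + 2 * pi * real j) ^ 2\<rfloor>" for j
  define \<nu> where "\<nu> j = (2::int) ^ m j" for j
  have m: "real (m j) = of_int \<lfloor>(\<theta> + 2 * pi * real j) ^ 2\<rfloor>" for j
    by (simp add: m_def)
  have y: "filterlim (\<lambda>j. \<theta> + 2 * pi * real j) at_top sequentially"
    by (intro filterlim_tendsto_add_at_top[OF tendsto_const]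
        filterlim_tendsto_pos_mult_at_top[OF tendsto_const] filterlim_real_sequentially) simp
  have "((\<lambda>y::real. sqrt (of_int \<lfloor>y ^ 2\<rfloor>) - y) \<longlongrightarrow> 0) at_top"
    by real_asymp
  from filterlim_compose[OF this y]
  have root: "(\<lambda>j. sqrt (real (m j)) - (\<theta> + 2 * pi * real j)) \<longlonglongrightarrow> 0"
    by (simp only: m)
  have cis: "(\<lambda>j. cis (sqrt (real (m j)))) \<longlonglongrightarrow> c"
  proof -
    have "cis (sqrt (real (m j))) = cis (sqrt (real (m j)) - (\<theta> + 2 * pi * real j)) * c" for j
    proof -
      have "cis (2 * pi * real j) = 1"
        by (rule cis_multiple_2pi) simp
      then have "cis (\<theta> + 2 * pi * real j) = c"
        by (simp add: \<theta>(2) flip: cis_mult)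
      then have "cis (sqrt (real (m j)) - (\<theta> + 2 * pi * real j)) * c
          = cis (sqrt (real (m j)) - (\<theta> + 2 * pi * real j)) * cis (\<theta> + 2 * pi * real j)"
        by simp
      then show ?thesis
        by (simp add: cis_mult)
    qed
    moreover have "(\<lambda>j. cis (sqrt (real (m j)) - (\<theta> + 2 * pi * real j)) * c) \<longlonglongrightarrow> cis 0 * c"
      by (intro tendsto_intros tendsto_cis root)
    ultimately show ?thesis by simp
  qed
  have mtop: "filterlim m at_top sequentially"
  proof -
    have "filterlim (\<lambda>y::real. of_int \<lfloor>y ^ 2\<rfloor> :: real) at_top at_top"
      by real_asymp
    from filterlim_compose[OF this y] have "filterlim (\<lambda>j. real (m j)) at_top sequentially"
      by (simp only: m)
    then show ?thesis
      by (simp add: filterlim_sequentially_iff_filterlim_real)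
  qed
  have big: "\<forall>\<^sub>F j in sequentially. k + \<nu> j \<noteq> 0" for k
  proof -
    have "\<forall>\<^sub>F j in sequentially. nat \<bar>k\<bar> \<le> m j"
      using mtop by (simp add: filterlim_at_top)
    then show ?thesis
    proof eventually_elim
      case (elim j)
      have "\<bar>k\<bar> < 2 ^ nat \<bar>k\<bar>"
        using of_nat_less_two_power[of "nat \<bar>k\<bar>", where ?'a = int] by simp
      also have "(2::int) ^ nat \<bar>k\<bar> \<le> \<nu> j"
        unfolding \<nu>_def using elim by (intro power_increasing) auto
      finally show ?case by linarith
    qed
  qed
  have ph: "(\<lambda>j. phase (iter (\<nu> j) (twin 1)) - c * phase (iter (\<nu> j) (twin 0))) \<longlonglongrightarrow> 0"
  proof -
    have "phase (iter (\<nu> j) (twin 1)) - c * phase (iter (\<nu> j) (twin 0))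
        = (cis (sqrt (real (m j))) - c) * phase (iter (\<nu> j) (twin 0))" for j
      using phase_iter_twins[of "m j"] by (simp add: \<nu>_def algebra_simps)
    moreover have "cmod (phase (iter (\<nu> j) (twin 0))) = 1" for j
      using iter_in[OF twin_in, of 0 "\<nu> j"] by (simp add: carrier_set_iff)
    ultimately have "norm (phase (iter (\<nu> j) (twin 1)) - c * phase (iter (\<nu> j) (twin 0)))
        = norm (cis (sqrt (real (m j))) - c)" for j
      by (simp add: norm_mult)
    then have "(\<lambda>j. norm (phase (iter (\<nu> j) (twin 1)) - c * phase (iter (\<nu> j) (twin 0)))) \<longlonglongrightarrow> 0"
      using tendsto_norm_zero[OF LIM_zero[OF cis]] by simp
    then show ?thesis
      by (rule tendsto_norm_zero_cancel)
  qed
  have "(\<lambda>j. iter (\<nu> j) (twin 1) k - spin c (iter (\<nu> j) (twin 0)) k) \<longlonglongrightarrow> 0" for k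
  proof (cases "k \<le> 1")
    case True
    have p: "iter (\<nu> j) (twin e) = point (residue (iter (\<nu> j) (twin e))) (symbol (iter (\<nu> j) (twin e)))
        (phase (iter (\<nu> j) (twin e)))" if "e \<in> {0, 1}" for j e
      using iter_in[OF twin_in[OF that], of "\<nu> j"] carrier_set_iff by blast
    have "iter (\<nu> j) (twin 1) 0 - spin c (iter (\<nu> j) (twin 0)) 0
        = Re (phase (iter (\<nu> j) (twin 1)) - c * phase (iter (\<nu> j) (twin 0)))"
      "iter (\<nu> j) (twin 1) 1 - spin c (iter (\<nu> j) (twin 0)) 1
        = Im (phase (iter (\<nu> j) (twin 1)) - c * phase (iter (\<nu> j) (twin 0)))" for j
      by (simp_all add: phase_def spin_def point_def)
    then show ?thesis
      using True tendsto_Re[OF ph] tendsto_Im[OF ph] by (cases "k = 0") (simp_all add: le_Suc_eq)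
  next
    case False
    have "\<forall>\<^sub>F j in sequentially. iter (\<nu> j) (twin 1) k - spin c (iter (\<nu> j) (twin 0)) k = 0"
      using big[of "int_decode ((k - 3) div 2)"]
    proof eventually_elim
      case (elim j)
      have "spin 1 (iter (\<nu> j) (twin 1)) k = spin c (iter (\<nu> j) (twin 0)) k"
        unfolding spin_def point_def
        using False filled_zero_eq[OF elim, of 1 0] by (auto simp: residue_iter symbol_iter)
      then show ?case
        by (simp add: spin_1)
    qed
    then show ?thesis
      by (rule tendsto_eventually)
  qed
  then show thesis
    by (rule that)
qed

section \<open>Minimality\<close>

text \<open>The residue modulo \<open>2 ^ i\<close> decides all symbols at positions where \<open>x + k\<close> is not divisible by
  \<open>2 ^ i\<close>.\<close>

lemma coherent_eq_of_residue:
  assumes x: "x \<in> odometer" "y \<in> odometer" "x i = y i" and "coherent x s" "coherent y t"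
    and k: "(x i + k) mod 2 ^ i \<noteq> 0"
  shows "s k = t k"
proof -
  obtain l where l: "(x (Suc l) + k) mod 2 ^ Suc l = 2 ^ l"
    using level_exists[OF x(1)] k by blast
  have "l < i"
  proof (rule ccontr)
    assume "\<not> l < i"
    then have "(2::int) ^ i dvd 2 ^ Suc l"
      by (intro le_imp_power_dvd) simp
    from mod_mod_cancel[OF this] have "(x i + k) mod 2 ^ i = (x (Suc l) + k) mod 2 ^ Suc l mod 2 ^ i"
      using odometer_add_mod[OF x(1), of i "Suc l" k] \<open>\<not> l < i\<close> by simp
    also have "\<dots> = 0"
      unfolding l using \<open>\<not> l < i\<close> by (simp add: le_imp_power_dvd)
    finally show False
      using k by simp
  qed
  then have "y (Suc l) = x (Suc l)"
    using odometer_mod[OF x(1), of "Suc l" i] odometer_mod[OF x(2), of "Suc l" i] x(3) by simp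
  then show ?thesis
    using assms(4,5) l unfolding coherent_def by metis
qed

text \<open>Density of the orbits in the space of pairs \<open>(x, s)\<close>.  Matching the residue modulo \<open>2 ^ i\<close> fixes
  all symbols in a window except possibly one, at a position \<open>k\<close>; this one is adjusted by giving
  \<open>x + k\<close> the valuation \<open>i\<close> or \<open>Suc i\<close>, according to the required parity.\<close>

lemma orbit_approximates:
  assumes g: "g \<in> carrier_set" and w: "w \<in> carrier_set"
  obtains n where "\<And>i. i \<le> m \<Longrightarrow> residue (iter n g) i = residue w i"
    "\<And>k. \<bar>k\<bar> \<le> int m \<Longrightarrow> symbol (iter n g) k = symbol w k"
proof -
  \<comment> \<open>With this choice two positions in the window cannot be congruent modulo \<open>2 ^ i\<close>.\<close>
  define i where "i = 2 * m + 1"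
  have small: "2 * int m < 2 ^ i"
  proof -
    have "2 * int m < int i"
      by (simp add: i_def)
    also have "int i < 2 ^ i"
      by (rule of_nat_less_two_power)
    finally show ?thesis .
  qed
  have xg: "residue g \<in> odometer" "coherent (residue g) (symbol g)"
    and xw: "residue w \<in> odometer" "coherent (residue w) (symbol w)"
    using g w by (simp_all add: carrier_set_iff)
  have xn: "residue (iter n g) \<in> odometer" "coherent (residue (iter n g)) (symbol (iter n g))" for n
    using iter_in[OF g, of n] by (simp_all add: carrier_set_iff)
  have below: "residue (iter n g) l = residue w l" if "residue (iter n g) i = residue w i" "l \<le> m" for n l
    using that odometer_mod[OF xn(1), of l i n] odometer_mod[OF xw(1), of l i] by (simp add: i_def)
  show thesis
  proof (cases "\<exists>k. \<bar>k\<bar> \<le> int m \<and> (residue w i + k) mod 2 ^ i = 0")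
    case True
    then obtain k where k: "\<bar>k\<bar> \<le> int m" "(residue w i + k) mod 2 ^ i = 0"
      by (elim exE conjE)
    define j where "j = (if symbol w k = of_bool (odd i) then i else Suc i)"
    have j: "i \<le> j" "symbol w k = of_bool (odd j)"
      using carrier_symbol[OF w, of k] by (auto simp: j_def)
    \<comment> \<open>After \<open>n\<close> steps the residue at level \<open>Suc j\<close> is \<open>2 ^ j - k\<close>.\<close>
    define n where "n = 2 ^ j - k - residue g (Suc j)"
    have lev: "(residue (iter n g) (Suc j) + k) mod 2 ^ Suc j = 2 ^ j"
    proof -
      have "(residue (iter n g) (Suc j) + k) mod 2 ^ Suc j = (2 ^ j) mod 2 ^ Suc j"
        unfolding residue_iter[OF g] mod_add_left_eq by (simp add: n_def del: power_Suc)
      then show ?thesis by simp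
    qed
    then have sk: "symbol (iter n g) k = symbol w k"
      using xn(2)[of n] unfolding coherent_def j(2) by blast
    have "(2::int) ^ i dvd 2 ^ Suc j"
      using j(1) by (intro le_imp_power_dvd) simp
    from mod_mod_cancel[OF this]
    have "(residue (iter n g) i + k) mod 2 ^ i = (residue (iter n g) (Suc j) + k) mod 2 ^ Suc j mod 2 ^ i"
      using odometer_add_mod[OF xn(1), of i "Suc j" n k] j(1) by simp
    also have "\<dots> = (residue w i + k) mod 2 ^ i"
      unfolding lev k(2) using j(1) by (simp add: le_imp_power_dvd)
    finally have "(residue (iter n g) i + k - k) mod 2 ^ i = (residue w i + k - k) mod 2 ^ i"
      by (rule mod_diff_cong) simp
    then have ri: "residue (iter n g) i = residue w i"
      using odometer_mod_self[OF xn(1)] odometer_mod_self[OF xw(1)] by simp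
    have "symbol (iter n g) l = symbol w l" if l: "\<bar>l\<bar> \<le> int m" for l
    proof (cases "l = k")
      case False
      have "(residue w i + l) mod 2 ^ i \<noteq> 0"
      proof
        assume "(residue w i + l) mod 2 ^ i = 0"
        then have "(2::int) ^ i dvd (residue w i + l) - (residue w i + k)"
          using k(2) by (intro dvd_diff) (auto simp: dvd_eq_mod_eq_0)
        then have "(2::int) ^ i dvd \<bar>l - k\<bar>"
          by simp
        then have "(2::int) ^ i \<le> \<bar>l - k\<bar>"
          using False by (intro zdvd_imp_le) auto
        then show False
          using small l k(1) by linarith
      qed
      then show ?thesis
        using coherent_eq_of_residue[OF xw(1) xn(1) ri[symmetric] xw(2) xn(2)] by simp
    qed (simp add: sk)
    then show thesis
      using that below[OF ri] by blast
  next
    case False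
    define n where "n = residue w i - residue g i"
    have ri: "residue (iter n g) i = residue w i"
      using odometer_mod_self[OF xw(1)] by (simp add: residue_iter[OF g] n_def)
    have "symbol (iter n g) l = symbol w l" if "\<bar>l\<bar> \<le> int m" for l
      using coherent_eq_of_residue[OF xw(1) xn(1) ri[symmetric] xw(2) xn(2)] False that by force
    then show thesis
      using that below[OF ri] by blast
  qed
qed

lemma twins_meet:
  assumes c: "cmod c = 1"
  obtains \<nu> :: "nat \<Rightarrow> int" and u where "u \<in> carrier_set"
    "(\<lambda>j. iter (\<nu> j) (twin 0)) \<longlonglongrightarrow> u" "(\<lambda>j. iter (\<nu> j) (twin 1)) \<longlonglongrightarrow> spin c u"
proof -
  obtain \<mu> :: "nat \<Rightarrow> int" where
    \<mu>: "\<And>k. (\<lambda>j. iter (\<mu> j) (twin 1) k - spin c (iter (\<mu> j) (twin 0)) k) \<longlonglongrightarrow> 0"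
    using twins_asymptotic[OF c] by blast
  have in0: "iter n (twin 0) \<in> carrier_set" for n
    by simp
  obtain u r where u: "u \<in> carrier_set" and r: "strict_mono (r :: nat \<Rightarrow> nat)"
    and lim: "((\<lambda>j. iter (\<mu> j) (twin 0)) \<circ> r) \<longlonglongrightarrow> u"
    using seq_compactE[OF compact_imp_seq_compact[OF compact_carrier], of "\<lambda>j. iter (\<mu> j) (twin 0)"] in0
    by blast
  have "(\<lambda>j. spin c (iter (\<mu> (r j)) (twin 0))) \<longlonglongrightarrow> spin c u"
    using spin_tendsto[OF lim] in0 by (simp add: o_def)
  then have "(\<lambda>j. spin c (iter (\<mu> (r j)) (twin 0)) k) \<longlonglongrightarrow> spin c u k" for k
    unfolding tendsto_coordinatewise o_def by blast
  then have "(\<lambda>j. (iter (\<mu> (r j)) (twin 1) k - spin c (iter (\<mu> (r j)) (twin 0)) k)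
      + spin c (iter (\<mu> (r j)) (twin 0)) k) \<longlonglongrightarrow> 0 + spin c u k" for k
    by (intro tendsto_add LIMSEQ_subseq_LIMSEQ[OF \<mu> r, unfolded o_def])
  then have "(\<lambda>j. iter (\<mu> (r j)) (twin 1)) \<longlonglongrightarrow> spin c u"
    unfolding tendsto_coordinatewise by simp
  then show thesis
    using that[of u "\<lambda>j. \<mu> (r j)"] u lim by (simp add: o_def)
qed

text \<open>The set contains points over each pair \<open>(x, s)\<close>, in particular \<open>a\<close> and \<open>b\<close> over the two twins.  The
  limits of their orbits along times at which the twins meet up to a prescribed rotation show that the set
  is invariant under all rotations.\<close>

lemma minimal_subset_is_everything:
  assumes M: "M \<subseteq> carrier_set" "closed M" "M \<noteq> {}" "\<And>n. iter n ` M \<subseteq> M"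
    and min: "\<And>N. \<lbrakk>N \<subseteq> M; closed N; N \<noteq> {}; \<And>n. iter n ` N \<subseteq> N\<rbrakk> \<Longrightarrow> N = M"
  shows "M = carrier_set"
proof -
  have cM: "compact M"
    using compact_Int_closed[OF compact_carrier M(2)] M(1) by (simp add: inf.absorb2)
  have orbit: "iter n g \<in> M" if "g \<in> M" for n g
    using M(4)[of n] that by blast
  have over: "\<exists>a\<in>M. residue a = residue w \<and> symbol a = symbol w" if w: "w \<in> carrier_set" for w
  proof -
    obtain g where g: "g \<in> M"
      using M(3) by blast
    then have gC: "g \<in> carrier_set"
      using M(1) by blast
    have "\<exists>n. (\<forall>i\<le>m. residue (iter n g) i = residue w i) \<and>
        (\<forall>k. \<bar>k\<bar> \<le> int m \<longrightarrow> symbol (iter n g) k = symbol w k)" for m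
      using orbit_approximates[OF gC w, of m] by metis
    then obtain n where n: "\<And>m i. i \<le> m \<Longrightarrow> residue (iter (n m) g) i = residue w i"
      "\<And>m k. \<bar>k\<bar> \<le> int m \<Longrightarrow> symbol (iter (n m) g) k = symbol w k"
      by metis
    have f: "iter (n m) g \<in> M" for m
      using M(4) g by blast
    obtain a r where a: "a \<in> M" and r: "strict_mono (r :: nat \<Rightarrow> nat)"
      and lim: "((\<lambda>m. iter (n m) g) \<circ> r) \<longlonglongrightarrow> a"
      using seq_compactE[OF compact_imp_seq_compact[OF cM], of "\<lambda>m. iter (n m) g"] f by blast
    have rm: "m \<le> r m" for m
      by (rule seq_suble[OF r])
    have D: "\<forall>\<^sub>F m in sequentially. residue (iter (n (r m)) g) i = residue a i"
      "\<forall>\<^sub>F m in sequentially. symbol (iter (n (r m)) g) k = symbol a k" for i k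
      using carrier_tendstoD[OF lim _ sequentially_bot] gC by (simp_all add: o_def)
    have "residue a i = residue w i" for i
    proof -
      have "\<forall>\<^sub>F m in sequentially. residue a i = residue w i"
        using D(1)[of i] eventually_ge_at_top[of i]
        by eventually_elim (metis n(1) order_trans rm)
      then show ?thesis by simp
    qed
    moreover have "symbol a k = symbol w k" for k
    proof -
      have "\<forall>\<^sub>F m in sequentially. symbol a k = symbol w k"
        using D(2)[of k] eventually_ge_at_top[of "nat \<bar>k\<bar>"]
      proof eventually_elim
        case (elim m)
        then have "\<bar>k\<bar> \<le> int (r m)"
          using rm[of m] by linarith
        then show ?case
          using n(2) elim by simp
      qed
      then show ?thesis by simp
    qed
    ultimately show ?thesis
      using a by (intro bexI[of _ a]) auto
  qed
  have inv: "spin d u \<in> M" if d: "cmod d = 1" and u: "u \<in> M" for d u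
  proof -
    \<comment> \<open>By minimality it is enough to find one point of \<open>M\<close> that the rotation keeps in \<open>M\<close>.\<close>
    define N where "N = M \<inter> {v \<in> carrier_set. spin d v \<in> M}"
    have "closed {v \<in> carrier_set. spin d v \<in> M}"
      using continuous_closed_preimage[OF continuous_on_spin closed_carrier M(2), of d]
      by (simp add: Collect_conj_eq vimage_def)
    then have "closed N"
      using M(2) by (simp add: N_def closed_Int)
    moreover have "iter n ` N \<subseteq> N" for n
    proof
      fix v assume "v \<in> iter n ` N"
      then obtain v' where v': "v' \<in> N" "v = iter n v'" by blast
      then show "v \<in> N"
        using M(4)[of n] spin_iter[OF d, of v' n] by (auto simp: N_def)
    qed
    moreover have "N \<noteq> {}"
    proof -
      obtain a b where ab: "a \<in> M" "b \<in> M" "residue (twin 1) = residue a" "symbol (twin 1) = symbol a"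
        "residue (twin 0) = residue b" "symbol (twin 0) = symbol b"
        using over[of "twin 1"] over[of "twin 0"] by auto
      obtain \<alpha> where \<alpha>: "cmod \<alpha> = 1" "a = spin \<alpha> (twin 1)"
        using same_fibre_spin[OF _ _ ab(3,4)] ab(1) M(1) by auto
      obtain \<beta> where \<beta>: "cmod \<beta> = 1" "b = spin \<beta> (twin 0)"
        using same_fibre_spin[OF _ _ ab(5,6)] ab(2) M(1) by auto
      \<comment> \<open>Letting the twins meet with this relative rotation brings the limits of \<open>a\<close> and \<open>b\<close> into
        the relative rotation \<open>d\<close>.\<close>
      define c where "c = d * \<beta> / \<alpha>"
      have c: "cmod c = 1" "\<alpha> * c = d * \<beta>"
        using d \<alpha>(1) \<beta>(1) by (auto simp: c_def norm_mult norm_divide)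
      obtain \<nu> and v where v: "v \<in> carrier_set" and lim0: "(\<lambda>j. iter (\<nu> j) (twin 0)) \<longlonglongrightarrow> v"
        and lim1: "(\<lambda>j. iter (\<nu> j) (twin 1)) \<longlonglongrightarrow> spin c v"
        using twins_meet[OF c(1)] by blast
      have "(\<lambda>j. iter (\<nu> j) b) \<longlonglongrightarrow> spin \<beta> v"
        using spin_tendsto[OF lim0, of \<beta>] by (simp add: \<beta> spin_iter)
      then have 0: "spin \<beta> v \<in> M"
        by (rule closed_sequentially[OF M(2) orbit[OF ab(2)]])
      have "(\<lambda>j. iter (\<nu> j) a) \<longlonglongrightarrow> spin \<alpha> (spin c v)"
        using spin_tendsto[OF lim1, of \<alpha>] v c(1) by (simp add: \<alpha> spin_iter)
      then have "spin \<alpha> (spin c v) \<in> M"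
        by (rule closed_sequentially[OF M(2) orbit[OF ab(1)]])
      then have "spin d (spin \<beta> v) \<in> M"
        by (simp add: spin_spin c(2))
      with 0 have "spin \<beta> v \<in> N"
        using M(1) by (auto simp: N_def)
      then show ?thesis by blast
    qed
    ultimately have "N = M"
      by (intro min) (auto simp: N_def)
    then show ?thesis
      using u by (auto simp: N_def)
  qed
  show ?thesis
  proof
    show "carrier_set \<subseteq> M"
    proof
      fix w assume w: "w \<in> carrier_set"
      obtain a where a: "a \<in> M" "residue a = residue w" "symbol a = symbol w"
        using over[OF w] by blast
      then obtain d where "cmod d = 1" "w = spin d a"
        using same_fibre_spin[OF _ w] M(1) by blast
      then show "w \<in> M"
        using inv a by blast
    qed
  qed (rule M(1))
qed

lemma minimal_flow_space: "minimal_cascade flow_space step"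
  unfolding minimal_cascade_def
proof (intro conjI ballI cascade_space)
  show "topspace flow_space \<noteq> {}"
    using twin_in[of 0] unfolding topspace_euclidean_subtopology by blast
  fix x assume x: "x \<in> topspace flow_space"
  let ?O = "flow_space closure_of range (\<lambda>n. iter n x)"
  have sub: "range (\<lambda>n. iter n x) \<subseteq> topspace flow_space"
    using x by auto
  have inv: "iter n ` ?O \<subseteq> ?O" for n
  proof -
    have "iter n ` ?O \<subseteq> flow_space closure_of (iter n ` range (\<lambda>n. iter n x))"
      by (rule continuous_map_image_closure_subset[OF continuous_map_zpow[OF homeomorphic_map_step]])
    also have "\<dots> \<subseteq> ?O"
    proof (rule closure_of_mono, clarify)
      fix m
      have "iter n (iter m x) = iter (n + m) x"
        using iter_add x by simp
      then show "iter n (iter m x) \<in> range (\<lambda>n. iter n x)"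
        by (metis rangeI)
    qed
    finally show ?thesis .
  qed
  have ne: "?O \<noteq> {}"
    using closure_of_subset[OF sub] by blast
  obtain M where M: "M \<subseteq> ?O" "closedin flow_space M" "M \<noteq> {}" "\<forall>n. iter n ` M \<subseteq> M"
    and min: "\<And>N. \<lbrakk>N \<subseteq> M; closedin flow_space N; N \<noteq> {}; \<forall>n. iter n ` N \<subseteq> N\<rbrakk> \<Longrightarrow> N = M"
  proof (rule minimal_closed_subset_exists[where P = "\<lambda>C. \<forall>n. iter n ` C \<subseteq> C",
        OF compact_Hausdorff_space(1) closedin_closure_of ne allI[OF inv]])
    fix \<C> assume *: "\<And>C. C \<in> \<C> \<Longrightarrow> closedin flow_space C \<and> (\<forall>n. iter n ` C \<subseteq> C)"
    show "\<forall>n. iter n ` \<Inter> \<C> \<subseteq> \<Inter> \<C>"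
    proof (intro allI subsetI InterI)
      fix n v C assume "v \<in> iter n ` \<Inter> \<C>" "C \<in> \<C>"
      then show "v \<in> C"
        using *[OF \<open>C \<in> \<C>\<close>] by blast
    qed
  qed (rule that)
  have "M = carrier_set"
  proof (rule minimal_subset_is_everything)
    show "M \<subseteq> carrier_set" "closed M"
      using M(2) closedin_closed_trans[OF _ closed_carrier] closedin_subset[OF M(2)] by auto
    fix N assume N: "N \<subseteq> M" "closed N" "N \<noteq> {}" "\<And>n. iter n ` N \<subseteq> N"
    have "closedin flow_space N"
      using N(1,2) closedin_subset[OF M(2)] by (auto intro!: closed_subset)
    then show "N = M"
      using min N by blast
  qed (use M in auto)
  then show "?O = topspace flow_space"
    using M(1) closure_of_subset_topspace[of flow_space] by auto
qed

section \<open>The tower\<close>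

text \<open>The stages forget coordinates by resetting them to the default \<open>x = 0\<close>, \<open>s = 0\<close>, \<open>z = 1\<close>; the
  residues are kept from stage \<open>1\<close> on, the symbols from stage \<open>2\<close> on and the phase from stage \<open>3\<close> on.
  Selecting coordinates of the sequence makes continuity evident.\<close>

definition stage :: "nat \<Rightarrow> (nat \<Rightarrow> real) \<Rightarrow> nat \<Rightarrow> real" where
  "stage i g n = (if n \<le> 1 then (if 3 \<le> i then g n else of_bool (n = 0))
     else if (if even n then 1 else 2) \<le> i then g n else 0)"

lemma stage_stage: "stage i (stage j g) = stage (min i j) g"
  by (auto simp: stage_def fun_eq_iff)

lemma stage_3 [simp]: "stage 3 g = g"
  by (auto simp: stage_def fun_eq_iff)

lemma stage_coords:
  "residue (stage i g) = (if 1 \<le> i then residue g else (\<lambda>_. 0))"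
  "symbol (stage i g) = (if 2 \<le> i then symbol g else (\<lambda>_. 0))"
  "phase (stage i g) = (if 3 \<le> i then phase g else 1)"
  by (auto simp: stage_def residue_def symbol_def phase_def fun_eq_iff complex_eq_iff)

lemma stage_point: "stage i (point x s z)
    = point (if 1 \<le> i then x else (\<lambda>_. 0)) (if 2 \<le> i then s else (\<lambda>_. 0)) (if 3 \<le> i then z else 1)"
  by (auto simp: stage_def point_def fun_eq_iff)

lemma stage_eq_iff:
  assumes "a \<in> carrier_set" "b \<in> carrier_set"
  shows "stage i a = stage i b \<longleftrightarrow> (1 \<le> i \<longrightarrow> residue a = residue b) \<and>
    (2 \<le> i \<longrightarrow> symbol a = symbol b) \<and> (3 \<le> i \<longrightarrow> phase a = phase b)"
proof -
  have st: "stage i g = point (if 1 \<le> i then residue g else (\<lambda>_. 0))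
      (if 2 \<le> i then symbol g else (\<lambda>_. 0)) (if 3 \<le> i then phase g else 1)"
    if "g \<in> carrier_set" for g
  proof -
    have "g = point (residue g) (symbol g) (phase g)"
      using that carrier_set_iff by blast
    from arg_cong[OF this, of "stage i"] show ?thesis
      unfolding stage_point .
  qed
  show ?thesis
    unfolding st[OF assms(1)] st[OF assms(2)] point_eq_iff by auto
qed

lemma stage_step: "stage i (step (stage i g)) = stage i (step g)"
  by (simp add: step_def stage_point stage_coords)

lemma stage_unstep: "stage i (unstep (stage i g)) = stage i (unstep g)"
  by (simp add: unstep_def stage_point stage_coords Let_def)

lemma continuous_on_stage: "continuous_on A (stage i)"
proof (rule continuous_on_coordinatewise_then_product)
  fix n
  show "continuous_on A (\<lambda>g. stage i g n)"
  proof -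
    have "continuous_on A (\<lambda>g. g n)"
      by (rule continuous_on_subset[OF continuous_on_product_coordinates]) simp
    then show ?thesis
      by (cases "n \<le> 1"; cases "3 \<le> i"; cases "1 \<le> i"; cases "2 \<le> i"; cases "even n")
        (simp_all add: stage_def)
  qed
qed

abbreviation stage_space :: "nat \<Rightarrow> (nat \<Rightarrow> real) topology" where
  "stage_space i \<equiv> top_of_set (stage i ` carrier_set)"

abbreviation stage_map :: "nat \<Rightarrow> (nat \<Rightarrow> real) \<Rightarrow> nat \<Rightarrow> real" where
  "stage_map i \<equiv> \<lambda>g. stage i (step g)"

lemma minimal_stage: "minimal_cascade (stage_space i) (stage_map i)"
proof (rule minimal_cascade_factor[OF minimal_flow_space, where \<phi> = "stage i"])
  show "continuous_map flow_space (stage_space i) (stage i)"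
    using continuous_on_stage by auto
  show "Hausdorff_space (stage_space i)"
    by (simp add: Hausdorff_space_subtopology)
  show "stage i (step a) = stage i (step b) \<longleftrightarrow> stage i a = stage i b"
    if "a \<in> topspace flow_space" "b \<in> topspace flow_space" for a b
  proof
    assume "stage i (step a) = stage i (step b)"
    then have "stage i (unstep (step a)) = stage i (unstep (step b))"
      by (metis stage_unstep)
    then show "stage i a = stage i b"
      using that by (simp add: unstep_step)
  qed (metis stage_step)
qed (simp_all add: stage_step)

lemma stage_hom:
  assumes "i \<le> k"
  shows "cascade_hom (stage_space k) (stage_map k) (stage_space i) (stage_map i) (stage i)"
proof (rule cascade_homI)
  show "cascade (stage_space k) (stage_map k)" "cascade (stage_space i) (stage_map i)"
    using minimal_stage by (simp_all add: minimal_cascade_def)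
  show "continuous_map (stage_space k) (stage_space i) (stage i)"
    using continuous_on_stage assms by (auto simp: stage_stage min_absorb1)
qed (use assms in \<open>simp add: stage_stage min_absorb1 stage_step\<close>)

lemma bij_betw_stage_map: "bij_betw (stage_map i) (stage i ` carrier_set) (stage i ` carrier_set)"
proof -
  have "homeomorphic_map (stage_space i) (stage_space i) (stage_map i)"
    using minimal_stage[of i] by (simp add: minimal_cascade_def cascade_def)
  from homeomorphic_map_imp_bij_betw[OF this] show ?thesis
    by simp
qed

lemma zpow_stage:
  assumes "g \<in> carrier_set"
  shows "zpow (stage_space i) (stage_map i) n (stage i g) = stage i (iter n g)"
proof -
  have "bij_betw (stage_map i) (topspace (stage_space i)) (topspace (stage_space i))"
    using bij_betw_stage_map by simp
  then have "stage i (iter n g) = zpow (stage_space i) (stage_map i) n (stage i g)"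
    by (rule zpow_equivariant[OF _ bij_step]) (use assms in \<open>auto simp: stage_step\<close>)
  then show ?thesis by simp
qed

lemma compact_stage: "compact (stage i ` carrier_set)"
  by (rule compact_continuous_image[OF continuous_on_stage compact_carrier])

text \<open>Translations of the odometer preserve the agreement of each single residue.\<close>

lemma equicontinuous_stage_1:
  "equicontinuous_extension (stage_space 1) (stage_map 1) (stage_space 0) (stage_map 0) (stage 0)"
proof (rule equicontinuous_extension_coordinatewise[OF compact_stage stage_hom bij_betw_stage_map])
  fix N :: nat and \<epsilon> :: real assume \<epsilon>: "\<epsilon> > 0"
  have same: "stage 1 (iter n g) k = stage 1 (iter n h) k"
    if C: "g \<in> carrier_set" "h \<in> carrier_set" and near: "\<bar>stage 1 g k - stage 1 h k\<bar> < 1" for g h n k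
  proof (cases "k \<le> 1 \<or> odd k")
    case True
    then show ?thesis by (auto simp: stage_def)
  next
    case False
    then obtain i where "k = 2 * Suc i"
      by (metis dvdE even_zero not0_implies_Suc le0 mult_0_right)
    then have k: "k = 2 * i + 2"
      by simp
    have st: "stage 1 u k = of_int (residue u i)" if "u \<in> carrier_set" for u
      using carrier_residue_coordinate[OF that, of i] by (simp add: stage_def k)
    have "\<bar>real_of_int (residue g i - residue h i)\<bar> < 1"
      using near unfolding st[OF C(1)] st[OF C(2)] by simp
    then have "residue g i = residue h i"
      by linarith
    then show ?thesis
      unfolding st[OF iter_in[OF C(1)]] st[OF iter_in[OF C(2)]] using C by (simp add: residue_iter)
  qed
  show "\<exists>M. \<exists>\<delta>>0. \<forall>a\<in>stage 1 ` carrier_set. \<forall>b\<in>stage 1 ` carrier_set.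
      stage 0 a = stage 0 b \<and> (\<forall>k<M. \<bar>a k - b k\<bar> < \<delta>) \<longrightarrow>
      (\<forall>n. \<forall>k<N. \<bar>zpow (stage_space 1) (stage_map 1) n a k - zpow (stage_space 1) (stage_map 1) n b k\<bar> < \<epsilon>)"
  proof (rule exI[of _ N], rule exI[of _ 1], intro conjI ballI impI allI)
    fix a b n k
    assume "a \<in> stage 1 ` carrier_set" "b \<in> stage 1 ` carrier_set"
      and near: "stage 0 a = stage 0 b \<and> (\<forall>k<N. \<bar>a k - b k\<bar> < 1)" and k: "k < N"
    then obtain g h where gh: "a = stage 1 g" "b = stage 1 h" "g \<in> carrier_set" "h \<in> carrier_set"
      by blast
    have "stage 1 (iter n g) k = stage 1 (iter n h) k"
      by (rule same[OF gh(3,4)]) (use near k gh in blast)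
    then show "\<bar>zpow (stage_space 1) (stage_map 1) n a k - zpow (stage_space 1) (stage_map 1) n b k\<bar> < \<epsilon>"
      using \<epsilon> unfolding gh(1,2) zpow_stage[OF gh(3)] zpow_stage[OF gh(4)] by simp
  qed simp
qed simp

text \<open>Two distinct points in a fibre over the odometer are translates of the twins, and these become
  asymptotic.\<close>

lemma proximal_stage_2:
  "proximal_extension (stage_space 2) (stage_map 2) (stage_space 1) (stage_map 1) (stage 1)"
  unfolding proximal_extension_def
proof (intro conjI ballI impI stage_hom)
  fix a b assume "a \<in> topspace (stage_space 2)" "b \<in> topspace (stage_space 2)"
    and eq: "stage 1 a = stage 1 b"
  then obtain g h where g: "g \<in> carrier_set" "a = stage 2 g" and h: "h \<in> carrier_set" "b = stage 2 h"
    by auto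
  have x: "residue g = residue h"
    using eq stage_eq_iff[OF g(1) h(1), of 1] by (simp add: g h stage_stage)
  show "proximal (stage_space 2) (stage_map 2) a b"
  proof (cases "symbol g = symbol h")
    case True
    then have "a = b"
      using x stage_eq_iff[OF g(1) h(1), of 2] by (simp add: g h)
    moreover have "a \<in> topspace (stage_space 2)"
      using g by simp
    ultimately show ?thesis
      using proximal_refl by metis
  next
    case False
    then obtain k where k: "symbol g k \<noteq> symbol h k" by blast
    obtain e e' c d where e: "{e, e'} = {0, 1}" "e \<noteq> e'" and cd: "cmod c = 1" "cmod d = 1"
      and gh: "g = iter (- k) (spin c (twin e))" "h = iter (- k) (spin d (twin e'))"
      using split_fibre[OF g(1) h(1) x k] by metis
    have E: "e = 0 \<or> e = 1" "e' = 0 \<or> e' = 1"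
      using e by auto
    have "cmod 1 = 1" by simp
    then obtain \<nu> and u where u: "u \<in> carrier_set" and lim: "(\<lambda>j. iter (\<nu> j) (twin 0)) \<longlonglongrightarrow> u"
      "(\<lambda>j. iter (\<nu> j) (twin 1)) \<longlonglongrightarrow> spin 1 u"
      using twins_meet by blast
    have lim': "(\<lambda>j. iter (\<nu> j) (twin \<epsilon>)) \<longlonglongrightarrow> u" if "\<epsilon> = 0 \<or> \<epsilon> = 1" for \<epsilon>
      using that lim u by (auto simp: spin_1)
    have st: "zpow (stage_space 2) (stage_map 2) (\<nu> j + k) (stage 2 (iter (- k) (spin \<gamma> (twin \<epsilon>))))
        = stage 2 (iter (\<nu> j) (twin \<epsilon>))" if \<epsilon>: "\<epsilon> = 0 \<or> \<epsilon> = 1" and \<gamma>: "cmod \<gamma> = 1" for \<epsilon> \<gamma> j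
    proof -
      have C: "twin \<epsilon> \<in> carrier_set" "spin \<gamma> (twin \<epsilon>) \<in> carrier_set"
        using \<epsilon> \<gamma> by auto
      then have "iter (\<nu> j + k) (iter (- k) (spin \<gamma> (twin \<epsilon>))) = spin \<gamma> (iter (\<nu> j) (twin \<epsilon>))"
        using iter_add[OF C(2), of "\<nu> j + k" "- k"] \<gamma> by (simp add: spin_iter)
      moreover have "stage 2 (spin \<gamma> w) = stage 2 w" if "w \<in> carrier_set" for w
        using stage_eq_iff[of "spin \<gamma> w" w 2] that \<gamma> by simp
      ultimately show ?thesis
        using C by (simp add: zpow_stage)
    qed
    have lim2: "limitin (stage_space 2) (\<lambda>j. zpow (stage_space 2) (stage_map 2) (\<nu> j + k)
          (stage 2 (iter (- k) (spin \<gamma> (twin \<epsilon>))))) (stage 2 u) sequentially"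
      if \<epsilon>: "\<epsilon> = 0 \<or> \<epsilon> = 1" and \<gamma>: "cmod \<gamma> = 1" for \<epsilon> \<gamma>
    proof -
      have "twin \<epsilon> \<in> carrier_set"
        using \<epsilon> by auto
      moreover have "(\<lambda>j. stage 2 (iter (\<nu> j) (twin \<epsilon>))) \<longlonglongrightarrow> stage 2 u"
        using continuous_on_tendsto_compose[OF continuous_on_stage[of UNIV 2] lim'[OF \<epsilon>]] by simp
      ultimately show ?thesis
        unfolding st[OF \<epsilon> \<gamma>] using u by (simp add: limitin_subtopology)
    qed
    show ?thesis
      unfolding g(2) h(2) gh
      by (rule proximal_sequence[OF lim2[OF E(1) cd(1)] lim2[OF E(2) cd(2)]])
  qed
qed simp

text \<open>Two points in a fibre over the second stage differ by a rotation, which commutes with the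
  iterates, so their distance never changes.\<close>

lemma equicontinuous_stage_3:
  "equicontinuous_extension (stage_space 3) (stage_map 3) (stage_space 2) (stage_map 2) (stage 2)"
proof (rule equicontinuous_extension_coordinatewise[OF compact_stage stage_hom bij_betw_stage_map])
  fix N :: nat and \<epsilon> :: real assume \<epsilon>: "\<epsilon> > 0"
  have close: "\<bar>iter n a k - iter n b k\<bar> < \<epsilon>"
    if a: "a \<in> carrier_set" and b: "b \<in> carrier_set" and eq: "stage 2 a = stage 2 b"
      and near: "\<forall>k<2. \<bar>a k - b k\<bar> < \<epsilon> / 2" for a b n k
  proof -
    have "residue a = residue b" "symbol a = symbol b"
      using eq stage_eq_iff[OF a b, of 2] by simp_all
    then obtain d where d: "cmod d = 1" "b = spin d a"
      using same_fibre_spin[OF a b] by blast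
    have "cmod (phase a - phase b) < \<epsilon>"
      using cmod_le[of "phase a - phase b"] near[rule_format, of 0] near[rule_format, of 1]
      by (simp add: phase_def)
    moreover have "cmod (phase u - d * phase u) = cmod (1 - d)" if "u \<in> carrier_set" for u
    proof -
      have "phase u - d * phase u = phase u * (1 - d)"
        by (simp add: algebra_simps)
      then show ?thesis
        using that by (simp add: norm_mult carrier_set_iff)
    qed
    ultimately have small: "cmod (phase (iter n a) - d * phase (iter n a)) < \<epsilon>"
      using a d(2) by simp
    have coord: "iter n a = point (residue (iter n a)) (symbol (iter n a)) (phase (iter n a))"
      using iter_in[OF a, of n] carrier_set_iff by blast
    have "\<bar>point x s z k - point x s z' k\<bar> < \<epsilon>" if "cmod (z - z') < \<epsilon>" for x s z z'
      using that abs_Re_le_cmod[of "z - z'"] abs_Im_le_cmod[of "z - z'"] \<epsilon> by (auto simp: point_def)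
    then have "\<bar>iter n a k - spin d (iter n a) k\<bar> < \<epsilon>"
      using small coord unfolding spin_def by metis
    then show ?thesis
      using spin_iter[OF d(1) a] by (simp add: d(2))
  qed
  show "\<exists>M. \<exists>\<delta>>0. \<forall>a\<in>stage 3 ` carrier_set. \<forall>b\<in>stage 3 ` carrier_set.
      stage 2 a = stage 2 b \<and> (\<forall>k<M. \<bar>a k - b k\<bar> < \<delta>) \<longrightarrow>
      (\<forall>n. \<forall>k<N. \<bar>zpow (stage_space 3) (stage_map 3) n a k - zpow (stage_space 3) (stage_map 3) n b k\<bar> < \<epsilon>)"
  proof (rule exI[of _ 2], rule exI[of _ "\<epsilon> / 2"], intro conjI ballI impI allI)
    fix a b n k
    assume ab: "a \<in> stage 3 ` carrier_set" "b \<in> stage 3 ` carrier_set"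
      and near: "stage 2 a = stage 2 b \<and> (\<forall>k<2. \<bar>a k - b k\<bar> < \<epsilon> / 2)"
    have "a \<in> carrier_set" "b \<in> carrier_set"
      using ab by simp_all
    then have "\<bar>iter n a k - iter n b k\<bar> < \<epsilon>"
      by (rule close) (use near in blast)+
    then show "\<bar>zpow (stage_space 3) (stage_map 3) n a k - zpow (stage_space 3) (stage_map 3) n b k\<bar> < \<epsilon>"
      by simp
  qed (use \<epsilon> in simp)
qed simp

lemma PI_tower_stages:
  "PI_tower (natLeq_on (Suc 3)) 3 stage_space stage_map (\<lambda>i k. stage i)"
proof (rule PI_tower_finiteI)
  show "\<exists>w. topspace (stage_space 0) = {w}"
  proof
    have "stage 0 g = point (\<lambda>_. 0) (\<lambda>_. 0) 1" for g
      by (auto simp: stage_def point_def fun_eq_iff)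
    moreover have "carrier_set \<noteq> {}"
      using twin_in[of 0] by blast
    ultimately show "topspace (stage_space 0) = {point (\<lambda>_. 0) (\<lambda>_. 0) 1}"
      by (simp add: image_constant_conv)
  qed
  show "proximal_extension (stage_space (Suc i)) (stage_map (Suc i)) (stage_space i) (stage_map i) (stage i) \<or>
      equicontinuous_extension (stage_space (Suc i)) (stage_map (Suc i)) (stage_space i) (stage_map i) (stage i)"
    if "i < 3" for i
  proof -
    from that consider "i = 0" | "i = 1" | "i = 2" by linarith
    then show ?thesis
    proof cases
      case 1
      then show ?thesis using equicontinuous_stage_1 by simp
    next
      case 2
      then show ?thesis using proximal_stage_2 by (simp add: numeral_2_eq_2)
    next
      case 3
      then show ?thesis using equicontinuous_stage_3 by (simp add: numeral_3_eq_3 numeral_2_eq_2)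
    qed
  qed
qed (auto simp: minimal_stage stage_hom stage_stage min_absorb1)

lemma stage_not_injective:
  assumes "i < 3"
  shows "\<not> homeomorphic_map (stage_space (Suc i)) (stage_space i) (stage i)"
proof
  assume "homeomorphic_map (stage_space (Suc i)) (stage_space i) (stage i)"
  then have inj: "inj_on (stage i) (stage (Suc i) ` carrier_set)"
    using homeomorphic_imp_injective_map by fastforce
  have same: "stage (Suc i) g = stage (Suc i) h" if "g \<in> carrier_set" "h \<in> carrier_set" "stage i g = stage i h" for g h
    using inj_onD[OF inj, of "stage (Suc i) g" "stage (Suc i) h"] that by (simp add: stage_stage min_absorb1)
  have C: "twin 0 \<in> carrier_set" "twin 1 \<in> carrier_set" "step (twin 0) \<in> carrier_set"
    "spin (- 1) (twin 0) \<in> carrier_set"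
    by simp_all
  from assms consider "i = 0" | "i = 1" | "i = 2" by linarith
  then show False
  proof cases
    case 1
    have "residue (twin 0) = residue (step (twin 0))"
      using same[OF C(1,3)] 1 stage_eq_iff[OF C(1,3), of 0] stage_eq_iff[OF C(1,3), of 1] by simp
    then have "residue (twin 0) 1 = residue (step (twin 0)) 1" by simp
    then show False by (simp add: step_def)
  next
    case 2
    have "symbol (twin 0) = symbol (twin 1)"
      using same[OF C(1,2)] 2 stage_eq_iff[OF C(1,2), of 1] stage_eq_iff[OF C(1,2), of 2]
      by (simp add: numeral_2_eq_2)
    then have "symbol (twin 0) 0 = symbol (twin 1) 0" by simp
    then show False by simp
  next
    case 3
    have "phase (twin 0) = phase (spin (- 1) (twin 0))"
      using same[OF C(1,4)] 3 stage_eq_iff[OF C(1,4), of 2] stage_eq_iff[OF C(1,4), of 3]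
      by (simp add: numeral_3_eq_3 numeral_2_eq_2)
    then show False by simp
  qed
qed

lemma stage_3_flow: "stage_space 3 = flow_space" "stage_map 3 = step"
  by (simp_all add: fun_eq_iff)

lemma PI_of_order_flow: "PI_of_order 3 flow_space step"
  unfolding PI_of_order_def
proof (intro exI conjI)
  show "PI_tower (natLeq_on (Suc 3)) 3 stage_space stage_map (\<lambda>i k. stage i)"
    by (rule PI_tower_stages)
qed (use stage_3_flow stage_not_injective in auto)

lemma PI_flow_flow_space: "PI_flow flow_space step"
proof (rule strictly_PI_imp_PI_flow[OF minimal_flow_space])
  have "inj (\<lambda>i (_ :: nat). real i)"
    by (auto simp: inj_def fun_eq_iff)
  then show "strictly_PI flow_space step"
    by (rule finite_PI_tower_imp_strictly_PI[OF PI_tower_stages stage_3_flow])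
qed

section \<open>Minimal left ideals\<close>

abbreviation envelope :: "((nat \<Rightarrow> real) \<Rightarrow> nat \<Rightarrow> real) set" where
  "envelope \<equiv> enveloping_semigroup flow_space step"

abbreviation pointwise :: "((nat \<Rightarrow> real) \<Rightarrow> nat \<Rightarrow> real) topology" where
  "pointwise \<equiv> product_topology (\<lambda>_. flow_space) (topspace flow_space)"

lemma envelope_in [simp]: "\<lbrakk>p \<in> envelope; g \<in> carrier_set\<rbrakk> \<Longrightarrow> p g \<in> carrier_set"
  using enveloping_semigroup_in[of p flow_space step g] by simp

lemma envelope_spin:
  assumes "p \<in> envelope" "cmod c = 1" "g \<in> carrier_set"
  shows "p (spin c g) = spin c (p g)"
proof (rule enveloping_semigroup_commute[OF cascade_space assms(1)])
  show "continuous_map flow_space flow_space (spin c)"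
    using continuous_on_spin assms(2) by auto
qed (use assms(3) in \<open>auto simp: spin_step\<close>)

lemma envelope_iter:
  assumes "p \<in> envelope" "g \<in> carrier_set"
  shows "p (iter n g) = iter n (p g)"
proof (rule enveloping_semigroup_commute[OF cascade_space assms(1)])
  show "continuous_map flow_space flow_space (iter n)"
    by (rule continuous_map_zpow[OF homeomorphic_map_step])
  show "iter n (step x) = step (iter n x)" if "x \<in> topspace flow_space" for x
    using iter_plus1[of x n] iter_add[of x n 1] iter_plus1[of x 0] that by simp
qed (use assms(2) in simp)

lemma continuous_apply:
  "g \<in> carrier_set \<Longrightarrow> continuous_map pointwise flow_space (\<lambda>p. p g)"
  using continuous_map_apply[of g flow_space] by simp

lemma continuous_residue: "continuous_map flow_space euclidean (\<lambda>g. residue g i)"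
proof -
  have "continuous_on carrier_set (\<lambda>g. residue g i)"
    unfolding continuous_on_sequentially
  proof (intro ballI allI impI, elim conjE)
    fix f l assume f: "\<forall>n. f n \<in> carrier_set" and lim: "f \<longlonglongrightarrow> l"
    show "((\<lambda>g. residue g i) \<circ> f) \<longlonglongrightarrow> residue l i"
      unfolding o_def by (intro tendsto_eventually carrier_tendstoD(1)[OF lim spec[OF f] sequentially_bot])
  qed
  then show ?thesis by simp
qed

text \<open>The iterates act on the odometer as translations, and for a single residue this is an identity
  between continuous functions; so it persists in the closure.\<close>

lemma envelope_residue:
  assumes p: "p \<in> envelope" and g: "g \<in> carrier_set"
  shows "residue (p g) i = (residue g i + residue (p (twin 0)) i) mod 2 ^ i"
proof -
  have c: "continuous_map pointwise euclidean (\<lambda>p. real_of_int (F (residue (p h) i)))"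
    if "h \<in> carrier_set" for h and F :: "int \<Rightarrow> int"
  proof -
    have "continuous_map euclidean euclidean (\<lambda>m. real_of_int (F m))"
      by simp
    from continuous_map_compose[OF continuous_map_compose[OF continuous_apply[OF that] continuous_residue] this]
    show ?thesis by (simp add: o_def)
  qed
  have "real_of_int (residue (p g) i) = real_of_int ((residue g i + residue (p (twin 0)) i) mod 2 ^ i)"
  proof (rule enveloping_semigroup_identity[OF p Hausdorff_space_euclidean])
    show "continuous_map pointwise euclideanreal (\<lambda>p. real_of_int (residue (p g) i))"
      by (rule c[OF g])
    show "continuous_map pointwise euclideanreal
        (\<lambda>p. real_of_int ((residue g i + residue (p (twin 0)) i) mod 2 ^ i))"
      by (rule c) simp
    show "real_of_int (residue (restrict (iter n) (topspace flow_space) g) i)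
        = real_of_int ((residue g i + residue (restrict (iter n) (topspace flow_space) (twin 0)) i) mod 2 ^ i)" for n
      using g by (simp add: residue_iter mod_add_right_eq)
  qed
  then show ?thesis
    by (simp only: of_int_eq_iff)
qed

text \<open>Translations of the odometer are surjective, so the range of \<open>p\<close> meets every fibre, although \<open>p\<close>
  is not surjective if it maps the twins into one circle.\<close>

lemma envelope_residue_surj:
  assumes p: "p \<in> envelope" and g: "g \<in> carrier_set"
  obtains a where "a \<in> carrier_set" "residue (p a) = residue g"
proof -
  define z where "z = residue (p (twin 0))"
  define x where "x = (\<lambda>i. (residue g i - z i) mod 2 ^ i)"
  have og: "residue g \<in> odometer" and oz: "z \<in> odometer"
    using g envelope_in[OF p twin_in[of 0]] by (simp_all add: carrier_set_iff z_def)
  have "x \<in> odometer"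
  proof -
    have "x (Suc i) mod 2 ^ i = x i" for i
    proof -
      have "(2::int) ^ i dvd 2 ^ Suc i"
        by (intro le_imp_power_dvd) simp
      then have "x (Suc i) mod 2 ^ i = (residue g (Suc i) - z (Suc i)) mod 2 ^ i"
        unfolding x_def by (rule mod_mod_cancel)
      also have "\<dots> = (residue g (Suc i) mod 2 ^ i - z (Suc i) mod 2 ^ i) mod 2 ^ i"
        by (simp add: mod_diff_eq)
      also have "\<dots> = x i"
        using og oz by (simp add: odometer_def x_def)
      finally show ?thesis .
    qed
    then show ?thesis
      by (simp add: odometer_def) (simp add: x_def)
  qed
  then have a: "point x (filled x 0) 1 \<in> carrier_set"
    by (simp add: filled_coherent)
  moreover have "residue (p (point x (filled x 0) 1)) = residue g"
    using envelope_residue[OF p a] odometer_mod_self[OF og]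
    by (simp add: fun_eq_iff x_def mod_add_left_eq flip: z_def)
  ultimately show thesis
    by (rule that)
qed

definition identifying :: "complex \<Rightarrow> ((nat \<Rightarrow> real) \<Rightarrow> nat \<Rightarrow> real) set" where
  "identifying c = {p \<in> envelope. p (twin 1) = spin c (p (twin 0))}"

lemma identifying_closed:
  assumes "cmod c = 1"
  shows "closedin pointwise (identifying c)"
proof -
  have "continuous_map pointwise flow_space (\<lambda>p. spin c (p (twin 0)))"
  proof -
    have "continuous_map flow_space flow_space (spin c)"
      using continuous_on_spin assms by auto
    from continuous_map_compose[OF continuous_apply this, of "twin 0"] show ?thesis
      by (simp add: o_def)
  qed
  moreover have "continuous_map pointwise flow_space (\<lambda>p. p (twin 1))"
    by (rule continuous_apply) simp
  ultimately have "closedin pointwise {p \<in> topspace pointwise. p (twin 1) = spin c (p (twin 0))}"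
    by (rule closedin_continuous_maps_eq[OF compact_Hausdorff_space(2), rotated])
  then have "closedin pointwise (envelope \<inter> {p \<in> topspace pointwise. p (twin 1) = spin c (p (twin 0))})"
    by (rule closedin_Int[OF enveloping_semigroup_closed])
  moreover have "envelope \<inter> {p \<in> topspace pointwise. p (twin 1) = spin c (p (twin 0))} = identifying c"
    using closedin_subset[OF enveloping_semigroup_closed] unfolding identifying_def by blast
  ultimately show ?thesis
    by metis
qed

text \<open>A cluster point of the iterates along times at which the twins are asymptotic up to \<open>c\<close>.\<close>

lemma identifying_nonempty:
  assumes c: "cmod c = 1"
  shows "identifying c \<noteq> {}"
proof -
  obtain \<nu> :: "nat \<Rightarrow> int" where
    \<nu>: "\<And>k. (\<lambda>j. iter (\<nu> j) (twin 1) k - spin c (iter (\<nu> j) (twin 0)) k) \<longlonglongrightarrow> 0"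
    using twins_asymptotic[OF c] by blast
  obtain p where p: "p \<in> envelope" and lim: "\<And>u :: _ \<Rightarrow> real. \<lbrakk>continuous_map pointwise euclidean u;
        (\<lambda>j. u (restrict (iter (\<nu> j)) (topspace flow_space))) \<longlonglongrightarrow> 0\<rbrakk> \<Longrightarrow> u p = 0"
  proof (rule enveloping_semigroup_cluster_point[OF cascade_space, of \<nu>])
  qed (rule that)
  have "p (twin 1) k - spin c (p (twin 0)) k = 0" for k
  proof (rule lim)
    have co: "continuous_map flow_space euclidean (\<lambda>g. g k)"
      by (simp add: continuous_on_subset[OF continuous_on_product_coordinates])
    have "continuous_map flow_space flow_space (spin c)"
      using continuous_on_spin c by auto
    note sp = continuous_map_compose[OF continuous_map_compose[OF continuous_apply this] co, of "twin 0"]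
    show "continuous_map pointwise euclidean (\<lambda>p. p (twin 1) k - spin c (p (twin 0)) k)"
      using continuous_map_compose[OF continuous_apply co, of "twin 1"] sp
      by (intro continuous_map_diff) (simp_all add: o_def)
    show "(\<lambda>j. restrict (iter (\<nu> j)) (topspace flow_space) (twin 1) k -
        spin c (restrict (iter (\<nu> j)) (topspace flow_space) (twin 0)) k) \<longlonglongrightarrow> 0"
      using \<nu>[of k] by simp
  qed
  then have "p (twin 1) = spin c (p (twin 0))"
    by (simp add: fun_eq_iff)
  then show ?thesis
    using p by (auto simp: identifying_def)
qed

lemma identifying_left_ideal:
  assumes c: "cmod c = 1"
  shows "left_ideal flow_space step (identifying c)"
  unfolding left_ideal_def
proof (intro conjI ballI identifying_nonempty c)
  fix p q assume p: "p \<in> envelope" and q: "q \<in> identifying c"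
  then have "q \<in> envelope" "q (twin 1) = spin c (q (twin 0))"
    by (simp_all add: identifying_def)
  then show "compose (topspace flow_space) p q \<in> identifying c"
    using enveloping_semigroup_compose[OF cascade_space p] envelope_spin[OF p c]
    by (simp add: identifying_def compose_def)
qed (auto simp: identifying_def)

lemma identifying_disjoint:
  assumes "p \<in> identifying c" "p \<in> identifying d"
  shows "c = d"
  using assms spin_cancel[of "p (twin 0)" c d] by (simp add: identifying_def)

text \<open>If some element of the ideal keeps the twins on different circles, their images are translates of
  the twins, so a further element that identifies the twins can be applied to bring them together.\<close>

lemma minimal_left_ideal_identifying:
  assumes I: "minimal_left_ideal flow_space step I"
  obtains c where "cmod c = 1" "I \<subseteq> identifying c"
proof -
  have li: "left_ideal flow_space step I"
    using I by (simp add: minimal_left_ideal_def)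
  then obtain q where q: "q \<in> I" "q \<in> envelope"
    by (auto simp: left_ideal_def)
  have C: "q (twin 0) \<in> carrier_set" "q (twin 1) \<in> carrier_set"
    using q(2) by simp_all
  have x: "residue (q (twin 0)) = residue (q (twin 1))"
    using envelope_residue[OF q(2), of "twin 0"] envelope_residue[OF q(2), of "twin 1"]
    by (simp add: fun_eq_iff)
  have sub: "I \<subseteq> identifying d" if d: "cmod d = 1" and r: "r \<in> I" "r (twin 1) = spin d (r (twin 0))" for r d
  proof (rule minimal_left_ideal_subset[OF I identifying_left_ideal[OF d]])
    have "r \<in> envelope"
      using li r(1) by (auto simp: left_ideal_def)
    then show "I \<inter> identifying d \<noteq> {}"
      using r by (auto simp: identifying_def)
  qed
  show thesis
  proof (cases "symbol (q (twin 0)) = symbol (q (twin 1))")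
    case True
    then obtain d where "cmod d = 1" "q (twin 1) = spin d (q (twin 0))"
      using same_fibre_spin[OF C x] by blast
    then show thesis
      using that sub q(1) by blast
  next
    case False
    then obtain k where "symbol (q (twin 0)) k \<noteq> symbol (q (twin 1)) k" by blast
    then obtain e e' c d where e: "{e, e'} = {0, 1}" "e \<noteq> e'" and cd: "cmod c = 1" "cmod d = 1"
      and eq: "q (twin 0) = iter (- k) (spin c (twin e))" "q (twin 1) = iter (- k) (spin d (twin e'))"
      using split_fibre[OF C x] by metis
    have E: "e = 0 \<and> e' = 1 \<or> e = 1 \<and> e' = 0"
      using e by (auto simp: doubleton_eq_iff)
    obtain p where p: "p \<in> identifying 1"
      using identifying_nonempty[of 1] by auto
    then have pE: "p \<in> envelope" and p1: "p (twin 1) = p (twin 0)"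
      by (auto simp: identifying_def spin_1)
    let ?r = "compose (topspace flow_space) p q"
    have r: "?r \<in> I"
      using li pE q(1) by (auto simp: left_ideal_def)
    define w where "w = p (twin 0)"
    have w: "w \<in> carrier_set" "p (twin e) = w" "p (twin e') = w"
      using pE p1 E by (auto simp: w_def)
    have tw: "twin e \<in> carrier_set" "twin e' \<in> carrier_set"
      using E by auto
    have "?r (twin 0) = iter (- k) (spin c w)" "?r (twin 1) = iter (- k) (spin d w)"
      using pE tw cd w by (simp_all add: compose_def eq envelope_iter envelope_spin)
    moreover have "iter (- k) (spin d w) = spin (d / c) (iter (- k) (spin c w))"
    proof -
      have "c \<noteq> 0" using cd by auto
      then show ?thesis
        using cd w by (simp add: spin_iter spin_spin norm_divide)
    qed
    ultimately have "?r (twin 1) = spin (d / c) (?r (twin 0))"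
      by simp
    moreover have "cmod (d / c) = 1"
      using cd by (simp add: norm_divide)
    ultimately show thesis
      using that sub r by blast
  qed
qed

text \<open>With \<open>q p = p\<close> in the first ideal, every element \<open>r\<close> of the second one satisfies \<open>r q = r\<close>: over
  a given residue, \<open>q\<close> fixes the circle that is hit by \<open>p\<close>; on the other circle, if there is one, it acts
  as the identification with relative rotation \<open>c\<close>, which \<open>r\<close> respects.\<close>

lemma minimal_left_ideal_unique:
  assumes c: "cmod c = 1" and I: "minimal_left_ideal flow_space step I" "I \<subseteq> identifying c"
    and J: "minimal_left_ideal flow_space step J" "J \<subseteq> identifying c"
  shows "I = J"
proof -
  have li: "left_ideal flow_space step I" "left_ideal flow_space step J"
    using I J by (simp_all add: minimal_left_ideal_def)
  then obtain p r where p: "p \<in> I" and r: "r \<in> J"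
    by (auto simp: left_ideal_def)
  obtain q where q: "q \<in> I" and qp: "compose (topspace flow_space) q p = p"
    using minimal_left_ideal_left_fix[OF cascade_space I(1) p] by blast
  have S: "p \<in> envelope" "q \<in> envelope" "r \<in> envelope"
    using li p q r by (auto simp: left_ideal_def)
  have q1: "q (twin 1) = spin c (q (twin 0))" and r1: "r (twin 1) = spin c (r (twin 0))"
    using q r I J by (auto simp: identifying_def)
  have fix_range: "q (p a) = p a" if "a \<in> carrier_set" for a
    using fun_cong[OF qp, of a] that by (simp add: compose_def)
  have "r (q g) = r g" if g: "g \<in> carrier_set" for g
  proof -
    obtain a where a: "a \<in> carrier_set" "residue (p a) = residue g"
      using envelope_residue_surj[OF S(1) g] by blast
    define b where "b = p a"
    have b: "b \<in> carrier_set" "residue b = residue g" "q b = b"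
      using a S fix_range by (simp_all add: b_def)
    show ?thesis
    proof (cases "symbol b = symbol g")
      case True
      then obtain d where "cmod d = 1" "g = spin d b"
        using same_fibre_spin[OF b(1) g b(2)] by blast
      then have "q g = g"
        using envelope_spin[OF S(2)] b by simp
      then show ?thesis by simp
    next
      case False
      then obtain k where "symbol b k \<noteq> symbol g k" by blast
      then obtain e e' \<beta> \<gamma> where e: "{e, e'} = {0, 1}" "e \<noteq> e'"
        and \<beta>\<gamma>: "cmod \<beta> = 1" "cmod \<gamma> = 1"
        and eq: "b = iter (- k) (spin \<beta> (twin e))" "g = iter (- k) (spin \<gamma> (twin e'))"
        using split_fibre[OF b(1) g b(2)] by metis
      have E: "e = 0 \<and> e' = 1 \<or> e = 1 \<and> e' = 0"
        using e by (auto simp: doubleton_eq_iff)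
      have tw: "twin e \<in> carrier_set" "twin e' \<in> carrier_set"
        using E by auto
      have "twin e = spin (1 / \<beta>) (iter k b)"
      proof -
        have "\<beta> \<noteq> 0" using \<beta>\<gamma> by auto
        then show ?thesis
          using iter_add[of "spin \<beta> (twin e)" k "- k"] tw \<beta>\<gamma> by (simp add: eq spin_spin spin_1)
      qed
      then have qe: "q (twin e) = twin e"
        using b \<beta>\<gamma> S(2) by (simp add: envelope_spin envelope_iter norm_divide)
      have "r (q (twin e')) = r (twin e')"
        using E
      proof
        assume "e = 0 \<and> e' = 1"
        then show ?thesis
          using qe q1 r1 envelope_spin[OF S(3) c] by simp
      next
        assume e: "e = 1 \<and> e' = 0"
        have "c \<noteq> 0" using c by auto
        then have inv: "spin (1 / c) (spin c h) = h" if "h \<in> carrier_set" for h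
          using that by (simp add: spin_spin spin_1)
        have "q (twin 0) = spin (1 / c) (twin 1)"
          using qe q1 e inv[of "q (twin 0)"] S(2) by simp
        then have "r (q (twin 0)) = spin (1 / c) (spin c (r (twin 0)))"
          using envelope_spin[OF S(3)] c r1 by (simp add: norm_divide)
        then show ?thesis
          using inv[of "r (twin 0)"] S(3) e by simp
      qed
      then show ?thesis
        using tw S \<beta>\<gamma> by (simp add: eq envelope_iter envelope_spin)
    qed
  qed
  then have "compose (topspace flow_space) r q = r"
    using S(2,3) by (intro enveloping_semigroup_eqI[OF enveloping_semigroup_compose[OF cascade_space S(3,2)] S(3)])
      (simp add: compose_def)
  then have "r \<in> I"
    using li(1) S(3) q by (metis left_ideal_def)
  then have "I \<inter> J \<noteq> {}" "J \<inter> I \<noteq> {}"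
    using r by auto
  then show ?thesis
    using minimal_left_ideal_subset[OF I(1) li(2)] minimal_left_ideal_subset[OF J(1) li(1)] by blast
qed

lemma minimal_left_ideals_eqpoll_circle:
  "{I. minimal_left_ideal flow_space step I} \<approx> {c :: complex. cmod c = 1}"
proof -
  define \<Phi> where "\<Phi> c = (SOME I. minimal_left_ideal flow_space step I \<and> I \<subseteq> identifying c)" for c
  have \<Phi>: "minimal_left_ideal flow_space step (\<Phi> c) \<and> \<Phi> c \<subseteq> identifying c" if c: "cmod c = 1" for c
    unfolding \<Phi>_def
  proof (rule someI_ex)
    show "\<exists>I. minimal_left_ideal flow_space step I \<and> I \<subseteq> identifying c"
      using minimal_left_ideal_exists[OF cascade_space identifying_left_ideal[OF c] identifying_closed[OF c]]
      by metis
  qed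
  have "bij_betw \<Phi> {c. cmod c = 1} {I. minimal_left_ideal flow_space step I}"
    unfolding bij_betw_def
  proof (intro conjI equalityI subsetI inj_onI)
    fix c d assume cd: "c \<in> {c. cmod c = 1}" "d \<in> {c. cmod c = 1}" "\<Phi> c = \<Phi> d"
    then obtain p where "p \<in> \<Phi> c"
      using \<Phi>[of c] by (auto simp: minimal_left_ideal_def left_ideal_def)
    then have "p \<in> identifying c" "p \<in> identifying d"
      using cd \<Phi>[of c] \<Phi>[of d] by auto
    then show "c = d"
      by (rule identifying_disjoint)
  next
    fix I assume "I \<in> {I. minimal_left_ideal flow_space step I}"
    then have I: "minimal_left_ideal flow_space step I" by simp
    then obtain c where "cmod c = 1" "I \<subseteq> identifying c"
      by (rule minimal_left_ideal_identifying)
    then have "I = \<Phi> c" "c \<in> {c. cmod c = 1}"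
      using minimal_left_ideal_unique[OF _ I] \<Phi>[of c] by auto
    then show "I \<in> \<Phi> ` {c. cmod c = 1}"
      by blast
  qed (use \<Phi> in auto)
  then show ?thesis
    by (meson eqpoll_def eqpoll_sym)
qed

section \<open>The theorem\<close>

lemma circle_eqpoll_continuum: "{c :: complex. cmod c = 1} \<approx> (UNIV :: nat set set)"
proof (rule lepoll_antisym)
  have "cis (Arg c) = c" if "cmod c = 1" for c
  proof -
    have "c \<noteq> 0"
      using that by auto
    then show ?thesis
      using cis_Arg[of c] that by (simp add: sgn_eq)
  qed
  then have "inj_on Arg {c. cmod c = 1}"
    by (intro inj_on_inverseI[where g = cis]) simp
  then have "{c. cmod c = 1} \<lesssim> (UNIV :: real set)"
    unfolding lepoll_def by blast
  then show "{c. cmod c = 1} \<lesssim> (UNIV :: nat set set)"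
    using nat_sets_eqpoll_reals by (meson eqpoll_sym lepoll_trans2)
next
  have "inj_on cis {0<..<1}"
  proof (rule inj_onI)
    fix x y :: real assume "x \<in> {0<..<1}" "y \<in> {0<..<1}" "cis x = cis y"
    then show "x = y"
      using cos_inj_pi[of x y] pi_gt3 by (auto simp: complex_eq_iff)
  qed
  then have "{0<..<1::real} \<lesssim> {c. cmod c = 1}"
    unfolding lepoll_def by (intro exI[of _ cis]) auto
  moreover have "{0<..<1::real} \<approx> (UNIV :: real set)"
    by (rule eqpoll_real_subset[of 0 1]) auto
  ultimately show "(UNIV :: nat set set) \<lesssim> {c. cmod c = 1}"
    using nat_sets_eqpoll_reals by (meson eqpoll_sym eqpoll_trans lepoll_trans1)
qed

theorem theorem3p3:
  shows "\<exists>(X :: (nat \<Rightarrow> real) topology) (T :: (nat \<Rightarrow> real) \<Rightarrow> (nat \<Rightarrow> real)).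
    compact_space X \<and> metrizable_space X \<and> homeomorphic_map X X T \<and>
    minimal_cascade X T \<and> PI_flow X T \<and> PI_of_order 3 X T \<and>
    {I. minimal_left_ideal X T I} \<approx> (UNIV :: nat set set)"
proof (intro exI conjI)
  show "compact_space flow_space"
    by (rule compact_Hausdorff_space)
  show "metrizable_space flow_space"
    by (simp add: metrizable_space_subtopology metrizable_space_euclidean)
  show "homeomorphic_map flow_space flow_space step"
    by (rule homeomorphic_map_step)
  show "minimal_cascade flow_space step"
    by (rule minimal_flow_space)
  show "PI_flow flow_space step"
    by (rule PI_flow_flow_space)
  show "PI_of_order 3 flow_space step"
    by (rule PI_of_order_flow)
  show "{I. minimal_left_ideal flow_space step I} \<approx> (UNIV :: nat set set)"
    by (rule eqpoll_trans[OF minimal_left_ideals_eqpoll_circle circle_eqpoll_continuum])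
qed

end
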